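(* Suppose $\alpha>0$, $\tau_1\ge0$, $\tau_2>0$, $1\le q<4$, and $1\le p<4$, where $p$ is a rational number with odd denominator. Let $s_1,s_2,t_1,t_2\ge0$ be given, and suppose that $s_1+s_2>0$, $t_1+t_2>0$, $s_1+t_1>0$, and $s_2+t_2>0$. Then $$I(s_1+s_2,t_1+t_2)<I(s_1,t_1)+I(s_2,t_2).$$
   Context: $H^1_{\mathbb{C}}$ is the $L^2$-based Sobolev space of complex-valued functions $f$ on $\mathbb{R}$ with $f,f'\in L^2$; $H^1$ is its subset of real-valued functions; $Y=H^1_{\mathbb{C}}\times H^1$. For $(u,v)\in Y$, $$E(u,v)=\int_{-\infty}^\infty\left(|u_x|^2+v_x^2-\beta_1|u|^{q+2}-\beta_2v^{p+2}-\alpha|u|^2v\right)dx,$$ where $\beta_1=\frac{2\tau_1}{q+2}$ and $\beta_2=\frac{2\tau_2}{(p+1)(p+2)}$. (Since $p$ has odd denominator, $v^{p+2}$ is defined also for $v<0$ through the odd root.) For $s\ge0$ and $t\ge0$, $I(s,t)=\inf\{E(f,g):(f,g)\in Y,\ \int|f|^2\,dx=s,\ \int g^2\,dx=t\}$. *)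

theory Defs
  imports "HOL-Analysis.Analysis"
begin

definition test_functions :: "(real \<Rightarrow> real) set" where
  "test_functions =
     {\<phi>. (\<forall>n x. (deriv ^^ n) \<phi> differentiable (at x)) \<and> compact (closure {x. \<phi> x \<noteq> 0})}"

definition has_weak_deriv :: "(real \<Rightarrow> 'a::euclidean_space) \<Rightarrow> (real \<Rightarrow> 'a) \<Rightarrow> bool" where
  "has_weak_deriv f g \<longleftrightarrow>
     (\<forall>a b. set_integrable lborel {a..b} f \<and> set_integrable lborel {a..b} g) \<and>
     (\<forall>\<phi>\<in>test_functions.
        (LBINT x. deriv \<phi> x *\<^sub>R f x) = - (LBINT x. \<phi> x *\<^sub>R g x))"

text \<open>A weak derivative is unique only up to a null set; any choice gives the same integrals.\<close>

definition weak_deriv :: "(real \<Rightarrow> 'a::euclidean_space) \<Rightarrow> real \<Rightarrow> 'a" where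
  "weak_deriv f = (SOME g. has_weak_deriv f g)"

definition L2 :: "(real \<Rightarrow> 'a::euclidean_space) set" where
  "L2 = {f. f \<in> borel_measurable lborel \<and> integrable lborel (\<lambda>x. (norm (f x))\<^sup>2)}"

text \<open>Elements are Borel representatives rather than almost-everywhere classes. The instances
  \<open>'a = complex\<close> and \<open>'a = real\<close> are the complex and the real Sobolev space.\<close>

definition H1 :: "(real \<Rightarrow> 'a::euclidean_space) set" where
  "H1 = {f \<in> L2. \<exists>g\<in>L2. has_weak_deriv f g}"

definition Y :: "((real \<Rightarrow> complex) \<times> (real \<Rightarrow> real)) set" where
  "Y = H1 \<times> H1"

text \<open>For a rational exponent \<open>m/n\<close> in lowest terms with \<open>n\<close> odd, \<open>root\<close> is the odd root also
  at negative arguments.\<close>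

definition odd_power :: "real \<Rightarrow> rat \<Rightarrow> real" where
  "odd_power x r = (case quotient_of r of (m, n) \<Rightarrow> root (nat n) x powi m)"

definition energy ::
  "real \<Rightarrow> real \<Rightarrow> real \<Rightarrow> real \<Rightarrow> rat \<Rightarrow> (real \<Rightarrow> complex) \<Rightarrow> (real \<Rightarrow> real) \<Rightarrow> real" where
  "energy \<alpha> \<tau>\<^sub>1 \<tau>\<^sub>2 q p u v =
     (let \<beta>\<^sub>1 = 2 * \<tau>\<^sub>1 / (q + 2);
          \<beta>\<^sub>2 = 2 * \<tau>\<^sub>2 / ((of_rat p + 1) * (of_rat p + 2))
      in LBINT x. (cmod (weak_deriv u x))\<^sup>2 + (weak_deriv v x)\<^sup>2
           - \<beta>\<^sub>1 * cmod (u x) powr (q + 2) - \<beta>\<^sub>2 * odd_power (v x) (p + 2)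
           - \<alpha> * (cmod (u x))\<^sup>2 * v x)"

text \<open>The infimum is taken in the extended reals, so that it does not presuppose that the energy
  is bounded below under the constraints.\<close>

definition min_energy ::
  "real \<Rightarrow> real \<Rightarrow> real \<Rightarrow> real \<Rightarrow> rat \<Rightarrow> real \<Rightarrow> real \<Rightarrow> ereal" where
  "min_energy \<alpha> \<tau>\<^sub>1 \<tau>\<^sub>2 q p s t =
     Inf {ereal (energy \<alpha> \<tau>\<^sub>1 \<tau>\<^sub>2 q p f g) | f g.
            (f, g) \<in> Y \<and> (LBINT x. (cmod (f x))\<^sup>2) = s \<and> (LBINT x. (g x)\<^sup>2) = t}"

end

theory Submission
  imports Defs
begin

text \<open>Two pairs of functions are superposed by \<open>u = sqrt (|u1|\<^sup>2 + |u2|\<^sup>2)\<close> and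
  \<open>v = sqrt (v1\<^sup>2 + v2\<^sup>2)\<close>. The masses add up, the reverse triangle inequality in the plane shows that the
  kinetic energies are subadditive, and all three potential terms are superadditive, strictly so
  where the pairs overlap. This gives \<open>I (s1 + s2) (t1 + t2) \<le> I s1 t1 + I s2 t2\<close> at once. For strictness
  a uniform overlap of near-minimisers suffices: as \<open>I 0 t < 0\<close>, subadditivity forbids the second
  component of a near-minimiser to be uniformly small if \<open>t > 0\<close>, hence after a translation it is
  bounded below on a fixed interval around the origin. No rearrangement and no compactness of
  minimising sequences is needed.\<close>

subsection \<open>Smooth bump functions\<close>

text \<open>No minimiser is available, so strictness has to be read off from near-minimisers: the
  gain of a superposition must be fixed before the tolerance is chosen. Height and width of the
  peaks may therefore depend only on the masses and the parameters; then two errors below the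
  tolerance lose against the gain. The components play different roles. The pure \<open>v\<close>
  term has a positive coefficient, which makes \<open>I 0 t\<close> negative. The coefficient of the
  pure \<open>u\<close> term may vanish, and then \<open>I s 0\<close> is not negative, so a pair
  without second component is made to profit from the coupling with the other pair's
  \<open>v\<close> peak. The bound 4 on the exponents acts through
  \<open>sobolev_sup_bound_quarter\<close>: the sup norm is of order \<open>D powr (1 / 4)\<close>
  in the kinetic energy \<open>D\<close>, so the power terms are of order
  \<open>D powr (q / 4)\<close> and \<open>D powr (p / 4)\<close> and cannot beat \<open>D\<close>.
  Moduli and square roots of Sobolev functions are not differentiable everywhere. What is easy to
  bound is their increments, which is why derivatives are recovered from increment bounds. The
  representatives in \<open>Y\<close> and the choice in \<open>weak_deriv\<close> are traded for
  continuous functions with an explicit derivative.\<close>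

definition flat_exp :: "real poly \<Rightarrow> real \<Rightarrow> real" where
  "flat_exp p x = (if x > 0 then poly p (1 / x) * exp (- 1 / x) else 0)"

lemma tendsto_poly_div_exp_0: "((\<lambda>x::real. poly p x * exp (- x)) \<longlongrightarrow> 0) at_top"
proof -
  have "((\<lambda>x::real. \<Sum>i\<le>degree p. coeff p i * (x ^ i / exp x)) \<longlongrightarrow> (\<Sum>i\<le>degree p. coeff p i * 0)) at_top"
    by (intro tendsto_intros tendsto_power_div_exp_0)
  then show ?thesis
    by (simp add: poly_altdef sum_distrib_right sum_divide_distrib exp_minus field_simps)
qed

text \<open>The polynomial in \<open>1 / x\<close> is carried along so that the family is closed
  under differentiation: the chain rule produces a factor \<open>1 / x^2\<close>, hence the
  polynomial X^2, and the exponential reproduces \<open>p\<close> next to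
  \<open>- pderiv p\<close>.\<close>

lemma has_real_derivative_flat_exp:
  "(flat_exp p has_real_derivative flat_exp ([:0, 0, 1:] * (p - pderiv p)) x) (at x)"
proof (cases x "0::real" rule: linorder_cases)
  case greater
  have "((\<lambda>x. poly p (1 / x) * exp (- 1 / x)) has_real_derivative
      flat_exp ([:0, 0, 1:] * (p - pderiv p)) x) (at x)"
    using greater
    by (auto intro!: derivative_eq_intros DERIV_chain2[OF poly_DERIV]
        simp: flat_exp_def field_simps power2_eq_square)
  then show ?thesis
    by (rule has_field_derivative_transform_within_open[of _ _ _ "{0<..}"])
       (use greater in \<open>auto simp: flat_exp_def\<close>)
next
  case less
  have "((\<lambda>x. 0) has_real_derivative flat_exp ([:0, 0, 1:] * (p - pderiv p)) x) (at x)"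
    using less by (auto simp: flat_exp_def)
  then show ?thesis
    by (rule has_field_derivative_transform_within_open[of _ _ _ "{..<0}"])
       (use less in \<open>auto simp: flat_exp_def\<close>)
next
  case equal
  \<comment> \<open>The difference quotient at 0 has an extra factor \<open>1 / h\<close>; it is
    absorbed by multiplying the polynomial by X, which is \<open>pCons 0 p\<close>.\<close>
  have "((\<lambda>h. poly (pCons 0 p) (1 / h) * exp (- (1 / h))) \<longlongrightarrow> 0) (at_right (0::real))"
    by (rule filterlim_compose[OF tendsto_poly_div_exp_0])
       (simp add: filterlim_inverse_at_top_right flip: inverse_eq_divide)
  then have "((\<lambda>h. (flat_exp p (0 + h) - flat_exp p 0) / h) \<longlongrightarrow> 0) (at_right 0)"
    by (rule Lim_transform_eventually)
       (auto simp: flat_exp_def eventually_at_filter)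
  moreover have "((\<lambda>h. (flat_exp p (0 + h) - flat_exp p 0) / h) \<longlongrightarrow> 0) (at_left 0)"
    by (rule Lim_transform_eventually[OF tendsto_const])
       (auto simp: flat_exp_def eventually_at_filter)
  ultimately show ?thesis
    unfolding DERIV_def using equal by (simp add: filterlim_split_at flat_exp_def)
qed

text \<open>An algebra of functions that is closed under differentiation, so all its members are smooth.\<close>

inductive flat_alg :: "(real \<Rightarrow> real) \<Rightarrow> bool" where
  base: "flat_alg (\<lambda>x. flat_exp p (c * x + d))"
| const: "flat_alg (\<lambda>x. c)"
| add: "flat_alg f \<Longrightarrow> flat_alg g \<Longrightarrow> flat_alg (\<lambda>x. f x + g x)"
| mult: "flat_alg f \<Longrightarrow> flat_alg g \<Longrightarrow> flat_alg (\<lambda>x. f x * g x)"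

lemma flat_alg_derivative:
  assumes "flat_alg f"
  shows "\<exists>f'. flat_alg f' \<and> (\<forall>x. (f has_real_derivative f' x) (at x))"
  using assms
proof induction
  case (base p c d)
  have "flat_alg (\<lambda>x. flat_exp ([:0, 0, 1:] * (p - pderiv p)) (c * x + d) * c)"
    by (intro flat_alg.intros)
  moreover have "((\<lambda>x. flat_exp p (c * x + d)) has_real_derivative
      flat_exp ([:0, 0, 1:] * (p - pderiv p)) (c * x + d) * c) (at x)" for x
    by (rule DERIV_chain2[OF has_real_derivative_flat_exp]) (auto intro!: derivative_eq_intros)
  ultimately show ?case by blast
next
  case (const c)
  then show ?case using flat_alg.const[of 0] by (auto intro!: exI[of _ "\<lambda>x. 0"])
next
  case (add f g)
  then obtain f' g' where "flat_alg f'" "\<forall>x. (f has_real_derivative f' x) (at x)"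
    "flat_alg g'" "\<forall>x. (g has_real_derivative g' x) (at x)" by blast
  then show ?case
    by (intro exI[of _ "\<lambda>x. f' x + g' x"]) (auto intro!: flat_alg.intros derivative_intros)
next
  case (mult f g)
  then obtain f' g' where "flat_alg f'" "\<forall>x. (f has_real_derivative f' x) (at x)"
    "flat_alg g'" "\<forall>x. (g has_real_derivative g' x) (at x)" by blast
  then show ?case using mult.hyps
    by (intro exI[of _ "\<lambda>x. f' x * g x + g' x * f x"])
      (auto intro!: flat_alg.intros DERIV_mult)
qed

lemma flat_alg_deriv: "flat_alg f \<Longrightarrow> flat_alg (deriv f)"
  using flat_alg_derivative[of f] by (metis DERIV_imp_deriv ext)

lemma flat_alg_differentiable: "flat_alg f \<Longrightarrow> (deriv ^^ n) f differentiable (at x)"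
proof -
  assume f: "flat_alg f"
  have "flat_alg ((deriv ^^ n) f)" by (induction n) (auto simp: f flat_alg_deriv)
  then show ?thesis
    using flat_alg_derivative[of "(deriv ^^ n) f"] by (auto simp: real_differentiable_def)
qed

lemma flat_alg_continuous: "flat_alg f \<Longrightarrow> continuous_on UNIV f"
  using flat_alg_differentiable[of f 0]
  by (auto intro!: differentiable_imp_continuous_on differentiable_at_imp_differentiable_on)

text \<open>The scaling by \<open>Suc n\<close> steepens both flanks, so that for fixed
  \<open>a\<close>, \<open>b\<close> the bumps converge pointwise to the indicator of the open
  interval while staying below it. Integrals over intervals become limits of integrals against
  smooth functions.\<close>

definition bump :: "real \<Rightarrow> real \<Rightarrow> nat \<Rightarrow> real \<Rightarrow> real" where
  "bump a b n x = flat_exp 1 ((x - a) * Suc n) * flat_exp 1 ((b - x) * Suc n)"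

lemma flat_alg_bump: "flat_alg (\<lambda>x. bump a b n (x - h))"
proof -
  have "flat_alg (\<lambda>x. flat_exp 1 (Suc n * x + - (a + h) * Suc n) * flat_exp 1 (- real (Suc n) * x + (b + h) * Suc n))"
    by (intro flat_alg.intros)
  then show ?thesis
    by (simp add: bump_def algebra_simps)
qed

lemma flat_exp_1_le: "0 \<le> flat_exp 1 x" "flat_exp 1 x \<le> 1"
  by (auto simp: flat_exp_def)

lemma bump_bounds: "0 \<le> bump a b n x" "bump a b n x \<le> indicator {a<..<b} x"
proof -
  show "0 \<le> bump a b n x" by (simp add: bump_def flat_exp_1_le)
  show "bump a b n x \<le> indicator {a<..<b} x"
  proof (cases "x \<in> {a<..<b}")
    case True
    then show ?thesis using mult_mono[OF flat_exp_1_le(2) flat_exp_1_le(2)]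
      by (simp add: bump_def flat_exp_1_le)
  next
    case False
    then have "(x - a) * Suc n \<le> 0 \<or> (b - x) * Suc n \<le> 0"
      by (auto simp: mult_le_0_iff)
    then show ?thesis using False by (auto simp: bump_def flat_exp_def simp del: of_nat_Suc)
  qed
qed

lemma continuous_bump: "continuous_on UNIV (bump a b n)"
  using flat_alg_continuous[OF flat_alg_bump[of a b n 0]] by simp

lemma tendsto_bump: "(\<lambda>n. bump a b n x) \<longlonglongrightarrow> indicator {a<..<b} x"
proof (cases "x \<in> {a<..<b}")
  case True
  have *: "(\<lambda>n. flat_exp 1 (y * Suc n)) \<longlonglongrightarrow> 1" if "y > 0" for y :: real
  proof -
    have "(\<lambda>n. exp (- (inverse y * inverse (real (Suc n))))) \<longlonglongrightarrow> exp (- (inverse y * 0))"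
      by (intro tendsto_intros LIMSEQ_inverse_real_of_nat)
    moreover have "flat_exp 1 (y * real (Suc n)) = exp (- (inverse y * inverse (real (Suc n))))" for n
      using that by (simp add: flat_exp_def zero_less_mult_iff divide_inverse)
    ultimately show ?thesis by simp
  qed
  show ?thesis
    unfolding bump_def using True tendsto_mult[OF *[of "x - a"] *[of "b - x"]] by simp
next
  case False
  then have "bump a b n x = 0" for n using bump_bounds[of a b n x] by simp
  then show ?thesis using False by simp
qed

lemma test_functionI:
  assumes "\<And>n x. (deriv ^^ n) f differentiable (at x)" "\<And>x. f x \<noteq> 0 \<Longrightarrow> x \<in> {a..b::real}"
  shows "f \<in> test_functions"
proof -
  have "closure {x. f x \<noteq> 0} \<subseteq> {a..b}"
    by (rule closure_minimal) (use assms(2) in auto)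
  then have "compact (closure {x. f x \<noteq> 0})"
    by (meson closed_closure compact_Icc compact_eq_bounded_closed bounded_subset)
  then show ?thesis using assms by (simp add: test_functions_def)
qed

lemma bump_test: "bump a b n \<in> test_functions"
proof (rule test_functionI)
  show "(deriv ^^ m) (bump a b n) differentiable (at x)" for m x
    using flat_alg_differentiable[OF flat_alg_bump[of a b n 0]] by simp
  show "x \<in> {a..b}" if "bump a b n x \<noteq> 0" for x
    using that bump_bounds[of a b n x] by (cases "x \<in> {a<..<b}") auto
qed

text \<open>An antiderivative of a bump is constant on either side of \<open>{a..b}\<close>, with
  different constants in general. Subtracting its translate cancels both constants, so the
  difference has compact support.\<close>

lemma bump_difference_test:
  assumes "h > 0"
  obtains \<phi> where "\<phi> \<in> test_functions" "\<And>x. deriv \<phi> x = bump a b n x - bump a b n (x - h)"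
proof -
  have "isCont (bump a b n) x" for x
    using continuous_bump by (simp add: continuous_on_eq_continuous_at)
  then obtain \<Psi> where \<Psi>: "\<And>x. (\<Psi> has_vector_derivative bump a b n x) (at x)"
    using einterval_antiderivative[of "-\<infinity>" \<infinity> "bump a b n"] by auto
  define \<phi> where "\<phi> x = \<Psi> x - \<Psi> (x - h)" for x
  have D\<Psi>: "(\<Psi> has_real_derivative bump a b n x) (at x)" for x
    using \<Psi> by (simp add: has_real_derivative_iff_has_vector_derivative)
  have D\<phi>: "(\<phi> has_real_derivative bump a b n x - bump a b n (x - h)) (at x)" for x
  proof -
    have "((\<lambda>x. \<Psi> (x - h)) has_real_derivative bump a b n (x - h) * 1) (at x)"
      by (rule DERIV_chain2[OF D\<Psi>]) (auto intro!: derivative_eq_intros)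
    then show ?thesis
      unfolding \<phi>_def by (auto intro!: derivative_intros D\<Psi>)
  qed
  have deriv: "deriv \<phi> = (\<lambda>x. bump a b n x - bump a b n (x - h))"
    using D\<phi> by (auto intro!: DERIV_imp_deriv)
  have "flat_alg (\<lambda>x. bump a b n (x - 0) + (- 1) * bump a b n (x - h))"
    by (intro flat_alg.intros flat_alg_bump)
  then have alg: "flat_alg (deriv \<phi>)"
    by (simp add: deriv)
  have const: "\<Psi> x = \<Psi> y" if "x < y" "y \<le> a \<or> b \<le> x" for x y
  proof (rule sym, rule DERIV_isconst_end[OF \<open>x < y\<close>])
    show "continuous_on {x..y} \<Psi>"
      using D\<Psi> by (meson DERIV_isCont continuous_at_imp_continuous_on)
    show "DERIV \<Psi> z :> 0" if "x < z" "z < y" for z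
      using D\<Psi>[of z] bump_bounds[of a b n z] that \<open>y \<le> a \<or> b \<le> x\<close>
      by (auto simp: indicator_def split: if_splits)
  qed
  have "\<phi> \<in> test_functions"
  proof (rule test_functionI)
    show "(deriv ^^ m) \<phi> differentiable (at x)" for m x
    proof (cases m)
      case 0
      then show ?thesis using D\<phi> by (auto simp: real_differentiable_def)
    next
      case (Suc k)
      then show ?thesis using flat_alg_differentiable[OF alg, of k]
        by (simp add: funpow_Suc_right del: funpow.simps)
    qed
    show "x \<in> {a..b + h}" if "\<phi> x \<noteq> 0" for x
      using that const[of "x - h" x] \<open>h > 0\<close> by (force simp: \<phi>_def)
  qed
  then show thesis using that deriv by simp
qed

subsection \<open>Weak derivatives and primitives\<close>

definition locally_integrable :: "(real \<Rightarrow> 'a::euclidean_space) \<Rightarrow> bool" where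
  "locally_integrable f \<longleftrightarrow> (\<forall>a b. set_integrable lborel {a..b} f)"

lemma locally_integrableD:
  assumes "locally_integrable f"
  shows "set_integrable lborel {a..b} f" "set_integrable lborel {a<..b} f"
    "set_integrable lborel {a<..<b} f"
  using assms by (auto simp: locally_integrable_def intro: set_integrable_subset[of _ "{a..b}"])

lemma locally_integrable_measurable:
  assumes "locally_integrable f"
  shows "f \<in> borel_measurable borel"
proof (rule borel_measurable_LIMSEQ_metric)
  fix n :: nat
  show "(\<lambda>x. indicator {- real n..real n} x *\<^sub>R f x) \<in> borel_measurable borel"
    using locally_integrableD(1)[OF assms, of "-n" n]
    unfolding set_integrable_def by (auto dest: borel_measurable_integrable)
next
  fix x :: real
  obtain N where N: "\<bar>x\<bar> \<le> real N" using real_arch_simple by blast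
  have "\<forall>\<^sub>F n in sequentially. f x = indicator {- real n..real n} x *\<^sub>R f x"
    using eventually_ge_at_top[of N] by eventually_elim (use N in \<open>auto simp: indicator_def\<close>)
  then show "(\<lambda>n. indicator {- real n..real n} x *\<^sub>R f x) \<longlonglongrightarrow> f x"
    by (rule Lim_transform_eventually[OF tendsto_const])
qed

lemma locally_integrable_continuous: "continuous_on UNIV f \<Longrightarrow> locally_integrable f"
  by (auto simp: locally_integrable_def intro!: borel_integrable_atLeastAtMost' intro: continuous_on_subset)

lemma locally_integrable_diff:
  "locally_integrable f \<Longrightarrow> locally_integrable g \<Longrightarrow> locally_integrable (\<lambda>x. f x - g x)"
  by (auto simp: locally_integrable_def intro!: set_integral_diff)

lemma locally_integrable_shift:
  assumes "locally_integrable f"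
  shows "locally_integrable (\<lambda>x. f (c + x))"
  unfolding locally_integrable_def set_integrable_def
proof (intro allI)
  fix a b
  have "(\<lambda>x. indicator {c + a..c + b} (c + 1 * x) *\<^sub>R f (c + 1 * x)) = (\<lambda>x. indicator {a..b} x *\<^sub>R f (c + x))"
    by (auto simp: indicator_def)
  then show "integrable lborel (\<lambda>x. indicator {a..b} x *\<^sub>R f (c + x))"
    using lborel_integrable_real_affine[of "\<lambda>x. indicator {c + a..c + b} x *\<^sub>R f x" 1 c]
      locally_integrableD(1)[OF assms, of "c + a" "c + b"]
    by (simp add: set_integrable_def)
qed

lemma set_integrable_bounded_mult:
  fixes g :: "real \<Rightarrow> 'a::euclidean_space"
  assumes "set_integrable lborel A g" "\<phi> \<in> borel_measurable borel" "\<And>x. \<bar>\<phi> x\<bar> \<le> B"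
    "\<And>x. x \<notin> A \<Longrightarrow> \<phi> x = 0"
  shows "integrable lborel (\<lambda>x. \<phi> x *\<^sub>R g x)"
proof -
  have "integrable lborel (\<lambda>x. \<phi> x *\<^sub>R (indicator A x *\<^sub>R g x))"
  proof (rule Bochner_Integration.integrable_bound)
    show "integrable lborel (\<lambda>x. B * norm (indicator A x *\<^sub>R g x))"
      using integrable_norm[OF assms(1)[unfolded set_integrable_def]]
      by (rule Bochner_Integration.integrable_mult_right)
    show "AE x in lborel. norm (\<phi> x *\<^sub>R indicator A x *\<^sub>R g x) \<le> norm (B * norm (indicator A x *\<^sub>R g x))"
    proof (intro always_eventually allI)
      fix x
      have "0 \<le> B" using assms(3)[of x] by linarith
      then show "norm (\<phi> x *\<^sub>R indicator A x *\<^sub>R g x) \<le> norm (B * norm (indicator A x *\<^sub>R g x))"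
        using assms(3)[of x] by (auto simp: abs_mult mult.assoc intro!: mult_right_mono)
    qed
    have "(\<lambda>x. indicator A x *\<^sub>R g x) \<in> borel_measurable lborel"
      using assms(1) by (auto simp: set_integrable_def)
    then show "(\<lambda>x. \<phi> x *\<^sub>R indicator A x *\<^sub>R g x) \<in> borel_measurable lborel"
      using assms(2) by (intro borel_measurable_scaleR[of \<phi> lborel "\<lambda>x. indicator A x *\<^sub>R g x"]) simp_all
  qed
  moreover have "(\<lambda>x. \<phi> x *\<^sub>R (indicator A x *\<^sub>R g x)) = (\<lambda>x. \<phi> x *\<^sub>R g x)"
  proof
    show "\<phi> x *\<^sub>R (indicator A x *\<^sub>R g x) = \<phi> x *\<^sub>R g x" for x
      using assms(4)[of x] by (cases "x \<in> A") simp_all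
  qed
  ultimately show ?thesis by simp
qed

lemma integrable_bump_mult:
  assumes "locally_integrable (g :: real \<Rightarrow> 'a::euclidean_space)"
  shows "integrable lborel (\<lambda>x. bump a b n x *\<^sub>R g x)"
proof (rule set_integrable_bounded_mult[OF locally_integrableD(1)[OF assms, of a b], of _ 1])
  show "bump a b n \<in> borel_measurable borel"
    by (rule borel_measurable_continuous_onI[OF continuous_bump])
  show "\<bar>bump a b n x\<bar> \<le> 1" "x \<notin> {a..b} \<Longrightarrow> bump a b n x = 0" for x
    using bump_bounds[of a b n x] by (cases "x \<in> {a<..<b}"; auto)+
qed

section \<open>The fundamental lemma of the calculus of variations\<close>

lemma AE_zero_of_interval_integrals:
  fixes h :: "real \<Rightarrow> 'a::euclidean_space"
  assumes "locally_integrable h" "\<And>a b. (LBINT x:{a<..<b}. h x) = 0"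
  shows "AE x in lborel. h x = 0"
proof -
  have int: "h integrable_on cbox a b" for a b
    using set_borel_integral_eq_integral(1)[OF locally_integrableD(1)[OF assms(1), of a b]] by simp
  have zero: "integral (cbox a b) h = 0" for a b
    using set_borel_integral_eq_integral(2)[OF locally_integrableD(3)[OF assms(1), of a b]]
      assms(2)[of a b] integral_open_interval[of a b h] by (simp add: box_real)
  \<comment> \<open>Lebesgue differentiation: off a null set, \<open>h x\<close> is the limit of the
    averages of \<open>h\<close> over \<open>{x..x + t}\<close>, and all of these vanish.\<close>
  obtain N where N: "negligible N"
    "\<And>x e. \<lbrakk>x \<notin> N; 0 < e\<rbrakk> \<Longrightarrow> \<exists>d>0. \<forall>t. 0 < t \<and> t < d \<longrightarrow>
       norm (integral (cbox x (x + t *\<^sub>R One)) h /\<^sub>R t ^ DIM(real) - h x) < e"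
    by (rule integrable_ccontinuous_explicit[OF int]) (rule that)
  have "h x = 0" if "x \<notin> N" for x
  proof (rule ccontr)
    assume "h x \<noteq> 0"
    then have "0 < norm (h x)" by simp
    from N(2)[OF that this] obtain d where "d > 0" and d: "\<forall>t. 0 < t \<and> t < d \<longrightarrow>
       norm (integral (cbox x (x + t *\<^sub>R One)) h /\<^sub>R t ^ DIM(real) - h x) < norm (h x)"
      by blast
    then show False using spec[OF d, of "d / 2"] unfolding zero by simp
  qed
  then have "AE x in lebesgue. h x = 0"
    using N(1) by (auto simp: negligible_iff_null_sets intro!: AE_I'[of N])
  moreover have "Measurable.pred borel (\<lambda>x. h x = 0)"
    using locally_integrable_measurable[OF assms(1)] by measurable
  ultimately show ?thesis
    by (simp add: AE_completion_iff)
qed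

text \<open>Dominated convergence along \<open>tendsto_bump\<close> turns the bump integrals into
  integrals over intervals.\<close>

lemma AE_zero_of_bump_integrals:
  fixes h :: "real \<Rightarrow> 'a::euclidean_space"
  assumes h: "locally_integrable h" and zero: "\<And>a b n. (LBINT x. bump a b n x *\<^sub>R h x) = 0"
  shows "AE x in lborel. h x = 0"
proof (rule AE_zero_of_interval_integrals[OF h])
  fix a b
  have [measurable]: "h \<in> borel_measurable borel" "bump a b n \<in> borel_measurable borel" for n
    using locally_integrable_measurable[OF h] borel_measurable_continuous_onI[OF continuous_bump] by auto
  have "(\<lambda>n. LBINT x. bump a b n x *\<^sub>R h x) \<longlonglongrightarrow> (LBINT x. indicator {a<..<b} x *\<^sub>R h x)"
  proof (rule integral_dominated_convergence)
    show "integrable lborel (\<lambda>x. norm (indicator {a<..<b} x *\<^sub>R h x))"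
      using locally_integrableD(3)[OF h, of a b] unfolding set_integrable_def by (rule integrable_norm)
    show "AE x in lborel. (\<lambda>n. bump a b n x *\<^sub>R h x) \<longlonglongrightarrow> indicator {a<..<b} x *\<^sub>R h x"
      by (intro always_eventually allI tendsto_intros tendsto_bump)
    show "AE x in lborel. norm (bump a b n x *\<^sub>R h x) \<le> norm (indicator {a<..<b} x *\<^sub>R h x)" for n
      using bump_bounds[of a b n] by (auto intro!: always_eventually mult_right_mono)
  qed measurable
  then show "(LBINT x:{a<..<b}. h x) = 0"
    by (simp add: zero set_lebesgue_integral_def LIMSEQ_const_iff)
qed

section \<open>Locally absolutely continuous functions\<close>

lemma set_integral_Ioc_eq_Icc:
  assumes "locally_integrable g"
  shows "(LBINT t:{a<..b}. g t) = (LBINT t:{a..b}. g t)"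
  unfolding set_lebesgue_integral_def
proof (rule integral_cong_AE)
  show "AE x in lborel. indicator {a<..b} x *\<^sub>R g x = indicator {a..b} x *\<^sub>R g x"
    using AE_lborel_singleton[of a] by eventually_elim (auto simp: indicator_def)
qed (use locally_integrable_measurable[OF assms] in measurable)

text \<open>Local absolute continuity of \<open>F\<close> with derivative \<open>g\<close>,
  expressed by increments instead of pointwise derivatives. Half-open intervals are disjoint when
  adjacent, so increments add up, and they match those of \<open>interval_measure\<close>.\<close>

definition primitive :: "(real \<Rightarrow> 'a::euclidean_space) \<Rightarrow> (real \<Rightarrow> 'a) \<Rightarrow> bool" where
  "primitive F g \<longleftrightarrow> locally_integrable g \<and> (\<forall>x y. x \<le> y \<longrightarrow> F y - F x = (LBINT t:{x<..y}. g t))"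

lemma primitiveD:
  assumes "primitive F g"
  shows "locally_integrable g" "x \<le> y \<Longrightarrow> F y - F x = (LBINT t:{x<..y}. g t)"
  using assms by (auto simp: primitive_def)

lemma primitive_exists:
  assumes g: "locally_integrable g"
  obtains F where "primitive F g"
proof -
  \<comment> \<open>For each \<open>x\<close> one of the two intervals is empty; this is the
    oriented integral from 0.\<close>
  define F where "F x = (LBINT t:{0<..x}. g t) - (LBINT t:{x<..0}. g t)" for x
  have add: "(LBINT t:{a<..c}. g t) = (LBINT t:{a<..b}. g t) + (LBINT t:{b<..c}. g t)"
    if "a \<le> b" "b \<le> c" for a b c
    using set_integral_Un[of "{a<..b}" "{b<..c}" lborel g] locally_integrableD(2)[OF g] that
    by (simp add: ivl_disj_un_two(6))
  have "F y - F x = (LBINT t:{x<..y}. g t)" if "x \<le> y" for x y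
  proof -
    have empty: "(LBINT t:{a<..b}. g t) = 0" if "b \<le> a" for a b
      using that by (simp add: set_lebesgue_integral_def)
    consider "0 \<le> x" | "y \<le> 0" | "x \<le> 0" "0 \<le> y" by linarith
    then show ?thesis
    proof cases
      case 1
      then show ?thesis using add[of 0 x y] that empty[of 0 x] empty[of 0 y] by (simp add: F_def)
    next
      case 2
      then show ?thesis using add[of x y 0] that empty[of x 0] empty[of y 0] by (simp add: F_def)
    next
      case 3
      then show ?thesis using add[of x 0 y] that empty[of x 0] empty[of 0 y] by (simp add: F_def)
    qed
  qed
  then show thesis using that[of F] g by (simp add: primitive_def)
qed

lemma primitive_continuous:
  assumes "primitive F g"
  shows "continuous_on UNIV F"
proof -
  have "isCont F x" for x
  proof -
    have Fx: "F (x - 1) + integral {x - 1..y} g = F y" if "y \<in> {x - 1..x + 1}" for y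
    proof -
      have "F y - F (x - 1) = (LBINT t:{x - 1<..y}. g t)"
        using primitiveD(2)[OF assms] that by auto
      also have "\<dots> = integral {x - 1..y} g"
        unfolding set_integral_Ioc_eq_Icc[OF primitiveD(1)[OF assms]]
        by (rule set_borel_integral_eq_integral(2)[OF locally_integrableD(1)[OF primitiveD(1)[OF assms]]])
      finally show ?thesis by (metis add_diff_cancel_left' diff_add_cancel add.commute)
    qed
    have "g integrable_on {x - 1..x + 1}"
      using set_borel_integral_eq_integral(1)[OF locally_integrableD(1)[OF primitiveD(1)[OF assms]]] .
    then have "continuous_on {x - 1..x + 1} (\<lambda>y. F (x - 1) + integral {x - 1..y} g)"
      by (intro continuous_intros indefinite_integral_continuous_1)
    then have "continuous_on {x - 1..x + 1} F"
      by (rule continuous_on_eq) (rule Fx)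
    then show "isCont F x"
      by (rule continuous_on_interior) simp
  qed
  then show ?thesis by (simp add: continuous_on_eq_continuous_at)
qed

lemma primitive_measurable: "primitive F g \<Longrightarrow> F \<in> borel_measurable borel"
  by (intro borel_measurable_continuous_onI primitive_continuous)

lemma test_functionD:
  assumes "\<phi> \<in> test_functions"
  obtains R where "R > 0" "\<And>x. (\<phi> has_real_derivative deriv \<phi> x) (at x)" "continuous_on UNIV \<phi>"
    "continuous_on UNIV (deriv \<phi>)" "\<And>x. R \<le> \<bar>x\<bar> \<Longrightarrow> \<phi> x = 0" "\<And>x. R \<le> \<bar>x\<bar> \<Longrightarrow> deriv \<phi> x = 0"
proof -
  have diff: "(deriv ^^ n) \<phi> differentiable (at x)" for n x
    using assms by (auto simp: test_functions_def)
  have D: "(\<phi> has_real_derivative deriv \<phi> x) (at x)" for x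
    using diff[of 0 x] by (metis DERIV_deriv_iff_real_differentiable funpow_0)
  have cont: "continuous_on UNIV ((deriv ^^ n) \<phi>)" for n
    by (meson diff differentiable_imp_continuous_within continuous_at_imp_continuous_on)
  have "bounded (closure {x. \<phi> x \<noteq> 0})"
    using assms by (auto simp: test_functions_def intro: compact_imp_bounded)
  then have "bounded {x. \<phi> x \<noteq> 0}"
    using bounded_subset closure_subset by blast
  then obtain R where R: "R > 0" "\<And>x. \<phi> x \<noteq> 0 \<Longrightarrow> norm x \<le> R"
    by (auto simp: bounded_pos)
  have zero: "\<phi> x = 0" if "R + 1 \<le> \<bar>x\<bar>" for x
    using R(2)[of x] that by auto
  \<comment> \<open>The margin 1 beyond \<open>R\<close> makes \<open>\<phi>\<close> vanish in a
    whole neighbourhood of \<open>x\<close>, so that its derivative vanishes too.\<close>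
  have "deriv \<phi> x = 0" if "R + 1 \<le> \<bar>x\<bar>" for x
  proof -
    have "((\<lambda>x. 0) has_real_derivative deriv \<phi> x) (at x)"
    proof (rule has_field_derivative_transform_within[OF D, of 1])
      show "\<phi> y = 0" if "dist y x < 1" for y
        using R(2)[of y] that \<open>R + 1 \<le> \<bar>x\<bar>\<close>
        by (cases "\<phi> y = 0") (auto simp: dist_real_def abs_if split: if_splits)
    qed auto
    then show ?thesis by (metis DERIV_const DERIV_unique)
  qed
  then show thesis
    using that[of "R + 1"] R(1) D cont[of 0] cont[of 1] zero by auto
qed

text \<open>Integration by parts when \<open>F\<close> is merely absolutely continuous: write
  \<open>F\<close> as an integral of \<open>g\<close> and exchange the order of integration.\<close>

lemma primitive_has_weak_deriv:
  fixes F :: "real \<Rightarrow> 'a::euclidean_space"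
  assumes F: "primitive F g"
  shows "has_weak_deriv F g"
proof -
  note g = primitiveD(1)[OF F]
  have "(LBINT x. deriv \<phi> x *\<^sub>R F x) = - (LBINT x. \<phi> x *\<^sub>R g x)" if \<phi>: "\<phi> \<in> test_functions" for \<phi>
  proof -
    obtain R where R: "R > 0" and D: "\<And>x. (\<phi> has_real_derivative deriv \<phi> x) (at x)"
      and cont: "continuous_on UNIV \<phi>" "continuous_on UNIV (deriv \<phi>)"
      and zero: "\<And>x. R \<le> \<bar>x\<bar> \<Longrightarrow> \<phi> x = 0" "\<And>x. R \<le> \<bar>x\<bar> \<Longrightarrow> deriv \<phi> x = 0"
      using test_functionD[OF \<phi>] by metis
    have [measurable]: "\<phi> \<in> borel_measurable borel" "deriv \<phi> \<in> borel_measurable borel"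
      "g \<in> borel_measurable borel"
      using cont borel_measurable_continuous_onI locally_integrable_measurable[OF g] by auto
    have FTC: "(LBINT x. indicator {t..R} x * deriv \<phi> x) = - \<phi> t" if "t \<le> R" for t
      using integral_FTC_Icc_real[OF that, of \<phi> "deriv \<phi>"] D cont(2) zero(1)[of R] R
      by (simp add: continuous_on_eq_continuous_at mult.commute)
    have "compact (deriv \<phi> ` {- R..R})"
      using cont(2) by (intro compact_continuous_image) (auto intro: continuous_on_subset)
    then obtain B where "\<And>x. x \<in> {- R..R} \<Longrightarrow> \<bar>deriv \<phi> x\<bar> \<le> B"
      by (force dest!: compact_imp_bounded simp: bounded_iff)
    then have B: "\<bar>deriv \<phi> x\<bar> \<le> B * indicator {- R..R} x" for x
      using zero(2)[of x] by (cases "x \<in> {- R..R}") auto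
    then have "B \<ge> 0" using B[of 0] R by (simp add: indicator_def)
    \<comment> \<open>The kernel on the triangle \<open>t \<le> x\<close>. Integrating over
      \<open>t\<close> first gives \<open>deriv \<phi> x\<close> times the increment of
      \<open>F\<close> from \<open>- R\<close>; integrating over \<open>x\<close> first gives
      \<open>- \<phi> t\<close> times \<open>g t\<close>, by the fundamental theorem on
      \<open>{t..R}\<close>.\<close>
    define K where "K x t = (deriv \<phi> x * indicator {..x} t) *\<^sub>R (indicator {- R<..R} t *\<^sub>R g t)" for x t
    have int_g: "integrable lborel (\<lambda>t. indicator {- R<..R} t *\<^sub>R g t)"
      using locally_integrableD(2)[OF g] by (simp add: set_integrable_def)
    have K_bound: "norm (K x t) \<le> B * indicator {- R..R} x * norm (indicator {- R<..R} t *\<^sub>R g t)" for x t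
      unfolding K_def norm_scaleR[of "deriv \<phi> x * _"]
      using B[of x] by (intro mult_right_mono) (auto simp: abs_mult indicator_def)
    have K_meas [measurable]: "case_prod K \<in> borel_measurable (lborel \<Otimes>\<^sub>M lborel)"
    proof -
      have "Measurable.pred (lborel \<Otimes>\<^sub>M lborel) (\<lambda>p::real \<times> real. snd p \<le> fst p)" by measurable
      moreover have "case_prod K = (\<lambda>p. (deriv \<phi> (fst p) * (if snd p \<le> fst p then 1 else 0)) *\<^sub>R
          (indicator {- R<..R} (snd p) *\<^sub>R g (snd p)))"
        by (auto simp: K_def indicator_def)
      ultimately show ?thesis by simp
    qed
    have K_int: "integrable lborel (K x)" for x
    proof (rule Bochner_Integration.integrable_bound)
      show "integrable lborel (\<lambda>t. B * indicator {- R..R} x * norm (indicator {- R<..R} t *\<^sub>R g t))"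
        using integrable_norm[OF int_g] by (rule Bochner_Integration.integrable_mult_right)
      show "K x \<in> borel_measurable lborel" unfolding K_def by measurable
      show "AE t in lborel. norm (K x t) \<le> norm (B * indicator {- R..R} x * norm (indicator {- R<..R} t *\<^sub>R g t))"
        using K_bound by (auto intro!: always_eventually intro: order_trans[OF _ abs_ge_self])
    qed
    have "integrable (lborel \<Otimes>\<^sub>M lborel) (case_prod K)"
    proof (rule lborel_pair.Fubini_integrable[OF K_meas])
      show "AE x in lborel. integrable lborel (\<lambda>t. case_prod K (x, t))" using K_int by simp
      show "integrable lborel (\<lambda>x. LBINT t. norm (case_prod K (x, t)))"
      proof (rule Bochner_Integration.integrable_bound)
        show "integrable lborel (\<lambda>x. B * indicator {- R..R} x * (LBINT t. norm (indicator {- R<..R} t *\<^sub>R g t)))"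
          by (intro Bochner_Integration.integrable_mult_left Bochner_Integration.integrable_mult_right) 
             (simp add: R less_imp_le)
        show "(\<lambda>x. LBINT t. norm (case_prod K (x, t))) \<in> borel_measurable lborel"
          by measurable
        have "(LBINT t. norm (K x t)) \<le> B * indicator {- R..R} x * (LBINT t. norm (indicator {- R<..R} t *\<^sub>R g t))" for x
          unfolding integral_mult_right_zero[symmetric]
          using K_bound K_int int_g
          by (intro integral_mono integrable_norm Bochner_Integration.integrable_mult_right) auto
        then show "AE x in lborel. norm (LBINT t. norm (case_prod K (x, t))) \<le>
            norm (B * indicator {- R..R} x * (LBINT t. norm (indicator {- R<..R} t *\<^sub>R g t)))"
          by (auto intro!: always_eventually intro: order_trans[OF _ abs_ge_self])
      qed
    qed
    then have Fubini: "(LBINT t. LBINT x. K x t) = (LBINT x. LBINT t. K x t)"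
      by (rule lborel_pair.Fubini_integral)
    have inner1: "(LBINT t. K x t) = deriv \<phi> x *\<^sub>R (F x - F (- R))" for x
    proof (cases "x \<in> {- R..R}")
      case True
      have "(LBINT t. K x t) = deriv \<phi> x *\<^sub>R (LBINT t. indicator {..x} t *\<^sub>R indicator {- R<..R} t *\<^sub>R g t)"
        unfolding K_def scaleR_scaleR[symmetric, of "deriv \<phi> x"] by (rule integral_scaleR_right)
      also have "(\<lambda>t. indicator {..x} t *\<^sub>R indicator {- R<..R} t *\<^sub>R g t) = (\<lambda>t. indicator {- R<..x} t *\<^sub>R g t)"
        using True by (auto simp: indicator_def)
      also have "(LBINT t. indicator {- R<..x} t *\<^sub>R g t) = F x - F (- R)"
        using primitiveD(2)[OF F, of "- R" x] True by (simp add: set_lebesgue_integral_def)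
      finally show ?thesis .
    next
      case False
      then have "deriv \<phi> x = 0" using zero(2)[of x] by auto
      then show ?thesis by (simp add: K_def)
    qed
    have inner2: "(LBINT x. K x t) = - (\<phi> t *\<^sub>R g t)" for t
    proof (cases "t \<in> {- R<..R}")
      case True
      have "K x t = (indicator {t..R} x * deriv \<phi> x) *\<^sub>R g t" for x
        using True zero(2)[of x] by (auto simp: K_def indicator_def)
      moreover have "integrable lborel (\<lambda>x. indicator {t..R} x * deriv \<phi> x)"
        using borel_integrable_atLeastAtMost'[of t R "deriv \<phi>"] cont(2)
        by (auto simp: set_integrable_def intro: continuous_on_subset)
      ultimately have "(LBINT x. K x t) = (LBINT x. indicator {t..R} x * deriv \<phi> x) *\<^sub>R g t"
        by (simp only: integral_scaleR_left)
      then show ?thesis using FTC[of t] True by simp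
    next
      case False
      then have "\<phi> t = 0" using zero(1)[of t] by auto
      then show ?thesis using False by (simp add: K_def)
    qed
    have int: "integrable lborel (\<lambda>x. deriv \<phi> x *\<^sub>R h x)" if "locally_integrable h" for h :: "real \<Rightarrow> 'a"
    proof (rule set_integrable_bounded_mult[OF locally_integrableD(1)[OF that, of "- R" R], of _ B])
      show "\<bar>deriv \<phi> x\<bar> \<le> B" for x
        using B[of x] \<open>B \<ge> 0\<close> by (cases "x \<in> {- R..R}") auto
      show "deriv \<phi> x = 0" if "x \<notin> {- R..R}" for x
        using zero(2)[of x] that by auto
    qed simp
    \<comment> \<open>This removes the constant \<open>F (- R)\<close> that the base point of the
      increment leaves behind.\<close>
    have "(LBINT x. deriv \<phi> x) = 0"
    proof -
      have "(\<lambda>x. indicator {- R..R} x * deriv \<phi> x) = deriv \<phi>"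
      proof
        show "indicator {- R..R} x * deriv \<phi> x = deriv \<phi> x" for x
          using zero(2)[of x] by (cases "R \<le> \<bar>x\<bar>") (auto simp: indicator_def)
      qed
      then show ?thesis using FTC[of "- R"] R zero(1)[of "- R"] by simp
    qed
    moreover have "integrable lborel (deriv \<phi>)"
    proof -
      have "integrable lborel (\<lambda>x. deriv \<phi> x *\<^sub>R (1::real))"
      proof (rule set_integrable_bounded_mult[of "{- R..R}" _ _ B])
        show "\<bar>deriv \<phi> x\<bar> \<le> B" for x
          using B[of x] \<open>B \<ge> 0\<close> by (cases "x \<in> {- R..R}") auto
        show "deriv \<phi> x = 0" if "x \<notin> {- R..R}" for x
          using zero(2)[of x] that by auto
      qed (auto intro!: borel_integrable_atLeastAtMost')
      then show ?thesis by simp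
    qed
    ultimately have "(LBINT x. deriv \<phi> x *\<^sub>R F x) = (LBINT x. deriv \<phi> x *\<^sub>R (F x - F (- R)))"
      using int[OF locally_integrable_continuous[OF primitive_continuous[OF F]]]
      by (simp add: scaleR_diff_right)
    also have "\<dots> = - (LBINT t. \<phi> t *\<^sub>R g t)"
      using Fubini by (simp add: inner1 inner2)
    finally show ?thesis .
  qed
  then show ?thesis
    using g locally_integrable_continuous[OF primitive_continuous[OF F]]
    by (simp add: has_weak_deriv_def locally_integrable_def)
qed

section \<open>Uniqueness of weak derivatives and continuous representatives\<close>

lemma has_weak_derivD:
  assumes "has_weak_deriv f g"
  shows "locally_integrable f" "locally_integrable g"
    "\<phi> \<in> test_functions \<Longrightarrow> (LBINT x. deriv \<phi> x *\<^sub>R f x) = - (LBINT x. \<phi> x *\<^sub>R g x)"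
  using assms by (auto simp: has_weak_deriv_def locally_integrable_def)

text \<open>Functions that agree a.e. have the same integrals against test functions, so the
  difference of the derivatives is orthogonal to all bumps. This makes the choice in
  \<open>weak_deriv\<close> harmless, also after a change of representative.\<close>

lemma has_weak_deriv_unique_AE:
  assumes "has_weak_deriv f g" "has_weak_deriv f' g'" "AE x in lborel. f x = f' x"
  shows "AE x in lborel. g x = g' x"
proof -
  note g = has_weak_derivD(2)[OF assms(1)] has_weak_derivD(2)[OF assms(2)]
  note f = has_weak_derivD(1)[OF assms(1)] has_weak_derivD(1)[OF assms(2)]
  have "AE x in lborel. g x - g' x = 0"
  proof (rule AE_zero_of_bump_integrals[OF locally_integrable_diff[OF g]])
    fix a b n
    obtain R where "continuous_on UNIV (deriv (bump a b n))"
      using test_functionD[OF bump_test] by metis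
    then have [measurable]: "deriv (bump a b n) \<in> borel_measurable borel"
      by (rule borel_measurable_continuous_onI)
    have [measurable]: "f \<in> borel_measurable borel" "f' \<in> borel_measurable borel"
      using f locally_integrable_measurable by auto
    have "(LBINT x. deriv (bump a b n) x *\<^sub>R f x) = (LBINT x. deriv (bump a b n) x *\<^sub>R f' x)"
      by (rule integral_cong_AE) (use assms(3) in auto)
    then have "(LBINT x. bump a b n x *\<^sub>R g x) = (LBINT x. bump a b n x *\<^sub>R g' x)"
      using has_weak_derivD(3)[OF assms(1) bump_test] has_weak_derivD(3)[OF assms(2) bump_test]
      by (metis neg_equal_iff_equal)
    then show "(LBINT x. bump a b n x *\<^sub>R (g x - g' x)) = 0"
      using integrable_bump_mult[OF g(1)] integrable_bump_mult[OF g(2)]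
      by (simp add: scaleR_diff_right)
  qed
  then show ?thesis by simp
qed

text \<open>Testing against differences of translated bumps shows that the difference of a function and
  a primitive of its weak derivative agrees a.e. with each of its translates; by Fubini it is then
  a.e. constant.\<close>

lemma du_Bois_Reymond:
  fixes f :: "real \<Rightarrow> 'a::euclidean_space"
  assumes "has_weak_deriv f g"
  obtains F where "primitive F g" "AE x in lborel. f x = F x"
proof -
  note f = has_weak_derivD(1)[OF assms] and g = has_weak_derivD(2)[OF assms]
  obtain F where F: "primitive F g" using primitive_exists[OF g] .
  note F' = has_weak_derivD[OF primitive_has_weak_deriv[OF F]]
  define k where "k x = f x - F x" for x
  have k: "locally_integrable k"
    unfolding k_def by (rule locally_integrable_diff[OF f F'(1)])
  have [measurable]: "k \<in> borel_measurable borel"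
    by (rule locally_integrable_measurable[OF k])
  have pos: "AE x in lborel. k (h + x) = k x" if "h > 0" for h
  proof -
    have "AE x in lborel. k (h + x) - k x = 0"
    proof (rule AE_zero_of_bump_integrals[OF locally_integrable_diff[OF locally_integrable_shift[OF k] k]])
      fix a b n
      obtain \<phi> where \<phi>: "\<phi> \<in> test_functions" "\<And>x. deriv \<phi> x = bump a b n x - bump a b n (x - h)"
        using bump_difference_test[OF \<open>h > 0\<close>] by metis
      have int: "integrable lborel (\<lambda>x. bump a b n (x - h) *\<^sub>R u x)" if "locally_integrable u"
        for u :: "real \<Rightarrow> 'a"
        using lborel_integrable_real_affine[OF integrable_bump_mult[OF locally_integrable_shift[OF that, of h], of a b n], of 1 "- h"]
        by simp
      have "(LBINT x. deriv \<phi> x *\<^sub>R f x) = (LBINT x. deriv \<phi> x *\<^sub>R F x)"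
        using F'(3)[OF \<phi>(1)] has_weak_derivD(3)[OF assms \<phi>(1)] by simp
      then have "(LBINT x. bump a b n x *\<^sub>R k x) = (LBINT x. bump a b n (x - h) *\<^sub>R k x)"
        using int[OF f] int[OF F'(1)] integrable_bump_mult[OF f, of a b n] integrable_bump_mult[OF F'(1), of a b n]
        by (simp add: k_def \<phi>(2) scaleR_diff_left scaleR_diff_right algebra_simps)
      also have "\<dots> = (LBINT x. bump a b n x *\<^sub>R k (h + x))"
        using lborel_integral_real_affine[of 1 "\<lambda>x. bump a b n (x - h) *\<^sub>R k x" h] by simp
      finally show "(LBINT x. bump a b n x *\<^sub>R (k (h + x) - k x)) = 0"
        using integrable_bump_mult[OF k, of a b n] integrable_bump_mult[OF locally_integrable_shift[OF k], of a b n h]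
        by (simp add: scaleR_diff_right)
    qed
    then show ?thesis by simp
  qed
  have all: "AE x in lborel. k (h + x) = k x" for h
  proof (cases h "0::real" rule: linorder_cases)
    case less
    have "AE x in lborel. k (- h + (h + 1 * x)) = k (h + 1 * x)"
      by (rule AE_borel_affine) (use pos[of "- h"] less in auto)
    then show ?thesis by (simp add: eq_commute)
  qed (use pos in auto)
  have "AE h in lborel. AE x in lborel. k (h + x) = k x"
    using all by simp
  then have "AE x in lborel. AE h in lborel. k (h + x) = k x"
    by (subst (asm) lborel_pair.AE_commute) measurable
  \<comment> \<open>A single \<open>x\<close> suffices: substituting \<open>h = y - x\<close> turns
    almost every \<open>h\<close> into almost every \<open>y\<close>, and \<open>k x\<close> is the
    constant.\<close>
  then obtain x where "AE h in lborel. k (h + x) = k x"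
    using eventually_happens'[of "ae_filter lborel"] by (auto simp: ae_filter_eq_bot_iff)
  then have "AE y in lborel. k ((- x + 1 * y) + x) = k x"
    by (intro AE_borel_affine) auto
  then have "AE y in lborel. f y = F y + k x"
    by (simp add: k_def algebra_simps)
  moreover have "primitive (\<lambda>y. F y + k x) g"
    using F by (simp add: primitive_def)
  ultimately show thesis using that by blast
qed

subsection \<open>Sobolev functions of one variable\<close>

text \<open>The increasing functions \<open>P + w\<close> and \<open>P - w\<close>, with \<open>P\<close> a primitive of \<open>G\<close>, induce measures
  with sum \<open>2 G dx\<close>; their Radon-Nikodym densities give the derivative of \<open>w\<close>.\<close>

lemma primitive_of_increment_bound:
  fixes w G :: "real \<Rightarrow> real"
  assumes G: "locally_integrable G" "\<And>x. 0 \<le> G x"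
    and w: "\<And>x y. x \<le> y \<Longrightarrow> \<bar>w y - w x\<bar> \<le> (LBINT t:{x<..y}. G t)"
  obtains g where "primitive w g" "AE x in lborel. \<bar>g x\<bar> \<le> G x"
proof -
  obtain P where P: "primitive P G" using primitive_exists[OF G(1)] .
  have wP: "\<bar>w y - w x\<bar> \<le> P y - P x" if "x \<le> y" for x y
    using w[OF that] primitiveD(2)[OF P that] by simp
  have [measurable]: "G \<in> borel_measurable borel" by (rule locally_integrable_measurable[OF G(1)])
  have contP: "isCont P x" for x
    using primitive_continuous[OF P] by (simp add: continuous_on_eq_continuous_at)
  have contw: "isCont w x" for x
  proof -
    have "((\<lambda>y. w y - w x) \<longlongrightarrow> 0) (at x)"
    proof (rule Lim_null_comparison)
      show "\<forall>\<^sub>F y in at x. norm (w y - w x) \<le> \<bar>P y - P x\<bar>"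
        using wP by (intro always_eventually allI) (smt (verit) real_norm_def)
      show "((\<lambda>y. \<bar>P y - P x\<bar>) \<longlongrightarrow> 0) (at x)"
        using contP[of x] by (auto intro!: tendsto_eq_intros simp: isCont_def)
    qed
    then show ?thesis by (simp add: isCont_def LIM_zero_iff)
  qed
  define F1 F2 where "F1 x = P x + w x" and "F2 x = P x - w x" for x
  have mono: "F1 x \<le> F1 y" "F2 x \<le> F2 y" if "x \<le> y" for x y
    using wP[OF that] by (auto simp: F1_def F2_def)
  have rcont: "continuous (at_right a) F1" "continuous (at_right a) F2" for a
    unfolding F1_def F2_def
    by (auto intro!: continuous_intros intro: continuous_at_imp_continuous_at_within contP contw)
  define \<nu>1 \<nu>2 where "\<nu>1 = interval_measure F1" and "\<nu>2 = interval_measure F2"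
  have em: "emeasure \<nu>1 {a<..b} = F1 b - F1 a" "emeasure \<nu>2 {a<..b} = F2 b - F2 a" if "a \<le> b" for a b
    unfolding \<nu>1_def \<nu>2_def using that mono rcont by (auto intro!: emeasure_interval_measure_Ioc)
  have sets [simp]: "sets \<nu>1 = sets borel" "sets \<nu>2 = sets borel" by (simp_all add: \<nu>1_def \<nu>2_def)
  define S where "S = measure_of UNIV (sets borel) (\<lambda>A. emeasure \<nu>1 A + emeasure \<nu>2 A)"
  have sets_S [simp]: "sets S = sets borel"
    by (simp add: S_def sigma_algebra.sigma_sets_eq[OF sets.sigma_algebra_axioms[of borel, simplified]])
  have S: "emeasure S A = emeasure \<nu>1 A + emeasure \<nu>2 A" if "A \<in> sets borel" for A
  proof (rule emeasure_measure_of[OF S_def])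
    show "countably_additive (sets S) (\<lambda>A. emeasure \<nu>1 A + emeasure \<nu>2 A)"
    proof (rule countably_additiveI)
      fix A :: "nat \<Rightarrow> real set" assume A: "range A \<subseteq> sets S" "disjoint_family A"
      then show "(\<Sum>i. emeasure \<nu>1 (A i) + emeasure \<nu>2 (A i)) = emeasure \<nu>1 (\<Union> (range A)) + emeasure \<nu>2 (\<Union> (range A))"
        using suminf_emeasure[of A \<nu>1] suminf_emeasure[of A \<nu>2]
        by (subst suminf_add[symmetric]) (auto intro!: summableI)
    qed
  qed (use that in \<open>auto simp: positive_def\<close>)
  have int_G: "emeasure (density lborel (\<lambda>x. ennreal (2 * G x))) {a<..b} = ennreal (2 * (P b - P a))"
    if "a \<le> b" for a b
  proof -
    have "emeasure (density lborel (\<lambda>x. ennreal (2 * G x))) {a<..b} = (\<integral>\<^sup>+x. ennreal (2 * (indicator {a<..b} x * G x)) \<partial>lborel)"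
      by (subst emeasure_density) (auto intro!: nn_integral_cong simp: indicator_def)
    also have "\<dots> = ennreal (LBINT x. 2 * (indicator {a<..b} x * G x))"
      using locally_integrableD(2)[OF G(1), of a b] G(2)
      by (intro nn_integral_eq_integral) (auto simp: set_integrable_def)
    finally show ?thesis
      using primitiveD(2)[OF P that] by (simp add: set_lebesgue_integral_def)
  qed
  \<comment> \<open>On the intersection-stable generator of half-open intervals the increments of
    \<open>w\<close> cancel: (P + w) + (P - w) = 2 P.\<close>
  have dens: "density lborel (\<lambda>x. ennreal (2 * G x)) = S"
  proof (rule measure_eqI_generator_eq[where E = "range (\<lambda>(a, b). {a<..b::real})" and A = "\<lambda>i. {- real i<..real i}" and \<Omega> = UNIV])
    show "Int_stable (range (\<lambda>(a, b). {a<..b::real}))"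
      by (auto simp: Int_stable_def)
    have "sets borel = sigma_sets UNIV (range (\<lambda>(a, b). {a<..b::real}))"
      by (subst borel_sigma_sets_Ioc) simp
    then show "sets (density lborel (\<lambda>x. ennreal (2 * G x))) = sigma_sets UNIV (range (\<lambda>(a, b). {a<..b}))"
      "sets S = sigma_sets UNIV (range (\<lambda>(a, b). {a<..b::real}))" by simp_all
    show "emeasure (density lborel (\<lambda>x. ennreal (2 * G x))) X = emeasure S X"
      if X: "X \<in> range (\<lambda>(a, b). {a<..b::real})" for X
    proof -
      obtain a b where ab: "X = {a<..b}" using X by auto
      show ?thesis
      proof (cases "a \<le> b")
        case True
        have "F1 a \<le> F1 b" "F2 a \<le> F2 b" using mono True by auto
        then show ?thesis unfolding ab
          using True by (simp add: int_G S em F1_def F2_def flip: ennreal_plus)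
      qed (simp add: ab)
    qed
    show "(\<Union>i. {- real i<..real i}) = UNIV"
    proof (intro equalityI subsetI UNIV_I)
      fix x :: real
      obtain n where "\<bar>x\<bar> < real n" using reals_Archimedean2 by blast
      then show "x \<in> (\<Union>i. {- real i<..real i})" by (auto intro!: exI[of _ n])
    qed
    show "emeasure (density lborel (\<lambda>x. ennreal (2 * G x))) {- real i<..real i} \<noteq> \<infinity>" for i
      by (subst int_G) auto
  qed auto
  have ac: "absolutely_continuous lborel \<nu>1" "absolutely_continuous lborel \<nu>2"
  proof -
    have "emeasure S N = 0" if "N \<in> null_sets lborel" for N
      using that absolutely_continuousI_density[of "\<lambda>x. ennreal (2 * G x)" lborel]
      by (auto simp: dens absolutely_continuous_def)
    then show "absolutely_continuous lborel \<nu>1" "absolutely_continuous lborel \<nu>2"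
      using S by (fastforce simp: absolutely_continuous_def null_sets_def)+
  qed
  obtain f1 where f1 [measurable]: "f1 \<in> borel_measurable lborel" and d1: "density lborel f1 = \<nu>1"
    using sigma_finite_measure.Radon_Nikodym[OF lborel.sigma_finite_measure_axioms ac(1)] by auto
  obtain f2 where f2 [measurable]: "f2 \<in> borel_measurable lborel" and d2: "density lborel f2 = \<nu>2"
    using sigma_finite_measure.Radon_Nikodym[OF lborel.sigma_finite_measure_axioms ac(2)] by auto
  have "density lborel (\<lambda>x. f1 x + f2 x) = S"
  proof (rule measure_eqI)
    fix A assume "A \<in> sets (density lborel (\<lambda>x. f1 x + f2 x))"
    then have [measurable]: "A \<in> sets borel" by simp
    show "emeasure (density lborel (\<lambda>x. f1 x + f2 x)) A = emeasure S A"
      unfolding S[OF \<open>A \<in> sets borel\<close>] d1[symmetric] d2[symmetric]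
      by (simp add: emeasure_density distrib_right nn_integral_add)
  qed simp
  then have "AE x in lborel. ennreal (2 * G x) = f1 x + f2 x"
    by (intro sigma_finite_measure.density_unique[OF lborel.sigma_finite_measure_axioms]) (auto simp: dens)
  then have f1_le: "AE x in lborel. f1 x \<le> ennreal (2 * G x)"
    by eventually_elim simp
  \<comment> \<open>As \<open>w\<close> is \<open>F1 - P\<close>, its density is that of
    \<open>F1\<close> minus \<open>G\<close>. The density of \<open>F1\<close> lies between 0 and
    \<open>2 * G\<close>, since adding \<open>f2\<close> gives exactly \<open>2 * G\<close>; hence
    \<open>g\<close> lies between \<open>- G\<close> and \<open>G\<close>.\<close>
  define g where "g x = enn2real (f1 x) - G x" for x
  have e1: "AE x in lborel. f1 x = ennreal (enn2real (f1 x)) \<and> enn2real (f1 x) \<le> 2 * G x"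
    using f1_le
  proof eventually_elim
    case (elim x)
    then have "f1 x < top" by (simp add: order_le_less_trans)
    then show ?case using elim G(2)[of x] enn2real_mono[OF elim] by simp
  qed
  have int1: "set_integrable lborel {a..b} (\<lambda>x. enn2real (f1 x))" for a b
    unfolding set_integrable_def
  proof (rule Bochner_Integration.integrable_bound)
    show "integrable lborel (\<lambda>x. 2 * (indicator {a..b} x *\<^sub>R G x))"
      using locally_integrableD(1)[OF G(1), of a b] by (simp add: set_integrable_def)
    show "AE x in lborel. norm (indicator {a..b} x *\<^sub>R enn2real (f1 x)) \<le> norm (2 * (indicator {a..b} x *\<^sub>R G x))"
      using e1 by eventually_elim (auto simp: indicator_def)
  qed measurable
  then have li1: "locally_integrable (\<lambda>x. enn2real (f1 x))" by (simp add: locally_integrable_def)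
  have F1_int: "F1 y - F1 x = (LBINT t:{x<..y}. enn2real (f1 t))" if "x \<le> y" for x y
  proof -
    have "ennreal (F1 y - F1 x) = (\<integral>\<^sup>+t. f1 t * indicator {x<..y} t \<partial>lborel)"
      using em(1)[OF that] by (simp add: emeasure_density flip: d1)
    also have "\<dots> = (\<integral>\<^sup>+t. ennreal (indicator {x<..y} t * enn2real (f1 t)) \<partial>lborel)"
      by (rule nn_integral_cong_AE) (use e1 in eventually_elim, auto simp: indicator_def)
    also have "\<dots> = ennreal (LBINT t:{x<..y}. enn2real (f1 t))"
      using locally_integrableD(2)[OF li1, of x y]
      by (subst nn_integral_eq_integral) (auto simp: set_integrable_def set_lebesgue_integral_def)
    finally show ?thesis
      using mono(1)[OF that] by (simp add: set_lebesgue_integral_def)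
  qed
  have "primitive w g"
    unfolding primitive_def
  proof (intro conjI allI impI)
    show "locally_integrable g" unfolding g_def by (intro locally_integrable_diff li1 G(1))
    fix x y :: real assume "x \<le> y"
    then show "w y - w x = (LBINT t:{x<..y}. g t)"
      using F1_int[of x y] primitiveD(2)[OF P, of x y]
      by (simp add: g_def F1_def set_integral_diff locally_integrableD[OF li1] locally_integrableD[OF G(1)])
  qed
  moreover have "AE x in lborel. \<bar>g x\<bar> \<le> G x"
    using e1 by eventually_elim (auto simp: g_def abs_le_iff)
  ultimately show thesis using that by blast
qed

text \<open>The continuous representative of an \<open>H1\<close> function together with a named
  derivative. Pointwise bounds then make sense everywhere, and integrals can be computed without the
  unspecified \<open>weak_deriv\<close>.\<close>

definition sobolev :: "(real \<Rightarrow> 'a::euclidean_space) \<Rightarrow> (real \<Rightarrow> 'a) \<Rightarrow> bool" where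
  "sobolev u u' \<longleftrightarrow> u \<in> L2 \<and> u' \<in> L2 \<and> primitive u u'"

lemma L2D:
  assumes "f \<in> L2"
  shows "f \<in> borel_measurable borel" "integrable lborel (\<lambda>x. (norm (f x))\<^sup>2)"
  using assms by (auto simp: L2_def)

lemma L2_locally_integrable:
  assumes "f \<in> L2"
  shows "locally_integrable f"
  unfolding locally_integrable_def set_integrable_def
proof (intro allI)
  fix a b
  show "integrable lborel (\<lambda>x. indicator {a..b} x *\<^sub>R f x)"
  proof (rule Bochner_Integration.integrable_bound)
    show "integrable lborel (\<lambda>x. indicator {a..b} x + (norm (f x))\<^sup>2)"
      using L2D(2)[OF assms] by (intro Bochner_Integration.integrable_add) (simp_all add: emeasure_lborel_Icc_eq)
    have "norm (f x) \<le> 1 + (norm (f x))\<^sup>2" for x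
    proof -
      have "2 * norm (f x) \<le> 1 + (norm (f x))\<^sup>2"
        using zero_le_power2[of "norm (f x) - 1"] by (simp add: power2_diff)
      then show ?thesis using norm_ge_zero[of "f x"] by linarith
    qed
    then show "AE x in lborel. norm (indicator {a..b} x *\<^sub>R f x) \<le> norm (indicator {a..b} x + (norm (f x))\<^sup>2)"
      by (auto simp: indicator_def)
  qed (use L2D(1)[OF assms] in measurable)
qed

lemma L2_cong_AE:
  assumes "f \<in> L2" "g \<in> borel_measurable borel" "AE x in lborel. f x = g x"
  shows "g \<in> L2"
proof -
  have "integrable lborel (\<lambda>x. (norm (g x))\<^sup>2)"
    by (rule integrable_cong_AE_imp[OF L2D(2)[OF assms(1)]]) (use assms(2,3) in auto)
  then show ?thesis using assms(2) by (simp add: L2_def)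
qed

lemma has_weak_deriv_weak_deriv:
  assumes "has_weak_deriv f g"
  shows "has_weak_deriv f (weak_deriv f)"
  unfolding weak_deriv_def using assms by (rule someI[of "has_weak_deriv f"])

lemma H1_sobolev:
  assumes "f \<in> H1"
  obtains u u' where "sobolev u u'" "AE x in lborel. f x = u x" "AE x in lborel. weak_deriv f x = u' x"
proof -
  obtain u' where f: "f \<in> L2" and u': "u' \<in> L2" "has_weak_deriv f u'"
    using assms by (auto simp: H1_def)
  obtain u where u: "primitive u u'" "AE x in lborel. f x = u x"
    using du_Bois_Reymond[OF u'(2)] .
  have "sobolev u u'"
    using u' u L2_cong_AE[OF f primitive_measurable[OF u(1)] u(2)] by (simp add: sobolev_def)
  moreover have "AE x in lborel. weak_deriv f x = u' x"
    using has_weak_deriv_unique_AE[OF has_weak_deriv_weak_deriv[OF u'(2)] u'(2)] by simp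
  ultimately show thesis using that u(2) by blast
qed

lemma sobolev_H1:
  assumes "sobolev u u'"
  shows "u \<in> H1" "AE x in lborel. weak_deriv u x = u' x"
proof -
  have *: "has_weak_deriv u u'" using assms primitive_has_weak_deriv by (auto simp: sobolev_def)
  then show "u \<in> H1" using assms by (auto simp: H1_def sobolev_def)
  show "AE x in lborel. weak_deriv u x = u' x"
    using has_weak_deriv_unique_AE[OF has_weak_deriv_weak_deriv[OF *] *] by simp
qed

lemma sobolev_measurable:
  assumes "sobolev u u'"
  shows "u \<in> borel_measurable borel" "u' \<in> borel_measurable borel"
  using assms L2D(1) by (auto simp: sobolev_def)

lemma H1_measurable:
  assumes "f \<in> H1"
  shows "f \<in> borel_measurable borel" "weak_deriv f \<in> borel_measurable borel"
proof -
  show "f \<in> borel_measurable borel" using assms L2D(1) by (auto simp: H1_def)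
  obtain g where "has_weak_deriv f g" using assms by (auto simp: H1_def)
  then show "weak_deriv f \<in> borel_measurable borel"
    using locally_integrable_measurable has_weak_derivD(2) has_weak_deriv_weak_deriv by blast
qed

text \<open>By the reverse triangle inequality the increments of the norm are at most the integral
  of \<open>norm (u' t)\<close>, so \<open>primitive_of_increment_bound\<close> applies. In the
  plane this gives the superposition of two functions, in the complex numbers the passage to the
  modulus.\<close>

lemma sobolev_norm:
  assumes "sobolev u u'"
  obtains w where "sobolev (\<lambda>x. norm (u x)) w" "AE x in lborel. \<bar>w x\<bar> \<le> norm (u' x)"
proof -
  have u: "u \<in> L2" "u' \<in> L2" "primitive u u'" using assms by (auto simp: sobolev_def)
  have nL2: "(\<lambda>x. norm (u x)) \<in> L2" "(\<lambda>x. norm (u' x)) \<in> L2"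
    using u by (auto simp: L2_def)
  have inc: "\<bar>norm (u y) - norm (u x)\<bar> \<le> (LBINT t:{x<..y}. norm (u' t))" if "x \<le> y" for x y
  proof -
    have "\<bar>norm (u y) - norm (u x)\<bar> \<le> norm (u y - u x)" by (rule norm_triangle_ineq3)
    also have "\<dots> \<le> (LBINT t:{x<..y}. norm (u' t))"
      unfolding primitiveD(2)[OF u(3) that]
      by (intro set_integral_norm_bound locally_integrableD L2_locally_integrable u)
    finally show ?thesis .
  qed
  obtain w where w: "primitive (\<lambda>x. norm (u x)) w" "AE x in lborel. \<bar>w x\<bar> \<le> norm (u' x)"
    using primitive_of_increment_bound[of "\<lambda>x. norm (u' x)" "\<lambda>x. norm (u x)"]
      L2_locally_integrable[OF nL2(2)] inc by auto
  have wm [measurable]: "w \<in> borel_measurable borel"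
    by (rule locally_integrable_measurable[OF primitiveD(1)[OF w(1)]])
  have "integrable lborel (\<lambda>x. (norm (w x))\<^sup>2)"
  proof (rule Bochner_Integration.integrable_bound[OF L2D(2)[OF u(2)]])
    show "AE x in lborel. norm ((norm (w x))\<^sup>2) \<le> norm ((norm (u' x))\<^sup>2)"
      using w(2) by eventually_elim (simp add: power_mono abs_le_square_iff[symmetric])
  qed measurable
  then have "sobolev (\<lambda>x. norm (u x)) w"
    using nL2 w wm by (auto simp: sobolev_def L2_def)
  then show thesis using that w(2) by blast
qed

lemma sobolev_Pair:
  assumes "sobolev u u'" "sobolev v v'"
  shows "sobolev (\<lambda>x. (u x, v x)) (\<lambda>x. (u' x, v' x))"
proof -
  have L2: "(\<lambda>x. (f x, g x)) \<in> L2" if "f \<in> L2" "g \<in> L2" for f :: "real \<Rightarrow> 'a" and g :: "real \<Rightarrow> 'b"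
    using that by (auto simp: L2_def norm_Pair borel_prod[symmetric])
  have p: "(\<lambda>x. (u' x, v' x)) \<in> L2" using L2 assms by (simp add: sobolev_def)
  have "(u y, v y) - (u x, v x) = (LBINT t:{x<..y}. (u' t, v' t))" if "x \<le> y" for x y
  proof (rule prod_eqI)
    have int: "integrable lborel (\<lambda>t. indicator {x<..y} t *\<^sub>R (u' t, v' t))"
      using locally_integrableD(2)[OF L2_locally_integrable[OF p]] by (simp add: set_integrable_def)
    show "fst ((u y, v y) - (u x, v x)) = fst (LBINT t:{x<..y}. (u' t, v' t))"
      using integral_bounded_linear[OF bounded_linear_fst int] primitiveD(2)[of u u' x y] assms that
      by (simp add: set_lebesgue_integral_def sobolev_def)
    show "snd ((u y, v y) - (u x, v x)) = snd (LBINT t:{x<..y}. (u' t, v' t))"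
      using integral_bounded_linear[OF bounded_linear_snd int] primitiveD(2)[of v v' x y] assms that
      by (simp add: set_lebesgue_integral_def sobolev_def)
  qed
  then show ?thesis
    using L2_locally_integrable[OF p] p L2[of u v] assms by (simp add: sobolev_def primitive_def)
qed

lemma sobolev_shift:
  assumes "sobolev u u'"
  shows "sobolev (\<lambda>x. u (c + x)) (\<lambda>x. u' (c + x))"
proof -
  have L2: "(\<lambda>x. f (c + x)) \<in> L2" if "f \<in> L2" for f :: "real \<Rightarrow> 'a"
    using L2D[OF that] lborel_integrable_real_affine[OF L2D(2)[OF that], of 1 c] by (simp add: L2_def)
  have "u (c + y) - u (c + x) = (LBINT t:{x<..y}. u' (c + t))" if "x \<le> y" for x y
  proof -
    have "u (c + y) - u (c + x) = (LBINT t. indicator {c + x<..c + y} t *\<^sub>R u' t)"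
      using primitiveD(2)[of u u' "c + x" "c + y"] that assms by (simp add: sobolev_def set_lebesgue_integral_def)
    also have "\<dots> = (LBINT t. indicator {c + x<..c + y} (c + t) *\<^sub>R u' (c + t))"
      using lborel_integral_real_affine[of 1 "\<lambda>t. indicator {c + x<..c + y} t *\<^sub>R u' t" c] by simp
    also have "\<dots> = (LBINT t:{x<..y}. u' (c + t))"
      by (simp add: set_lebesgue_integral_def indicator_def)
    finally show ?thesis .
  qed
  then show ?thesis
    using assms L2 L2_locally_integrable[OF L2[of u']] by (simp add: sobolev_def primitive_def)
qed

section \<open>Hoelder continuity and sup bounds\<close>

lemma sobolev_integrable:
  fixes u :: "real \<Rightarrow> real"
  assumes "sobolev u u'"
  shows "integrable lborel (\<lambda>x. (u x)\<^sup>2)" "integrable lborel (\<lambda>x. (u' x)\<^sup>2)"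
  using assms L2D(2)[of u] L2D(2)[of u'] by (auto simp: sobolev_def)

lemma set_integral_le_integral:
  fixes f :: "real \<Rightarrow> real"
  assumes "integrable lborel f" "A \<in> sets borel" "\<And>x. 0 \<le> f x"
  shows "(LBINT x:A. f x) \<le> (LBINT x. f x)"
  unfolding set_lebesgue_integral_def
  using assms by (intro integral_mono integrable_mult_indicator) (auto simp: indicator_def)

text \<open>Cauchy-Schwarz by optimising Young's inequality: for every \<open>k > 0\<close>, twice
  the increment \<open>d\<close> is at most \<open>k * (y - x) + D / k\<close>. The choice
  \<open>k = d / (y - x)\<close> makes the first term equal to \<open>d\<close> and leaves
  \<open>d \<le> D * (y - x) / d\<close>.\<close>

lemma sobolev_Hoelder:
  fixes u :: "real \<Rightarrow> real"
  assumes "sobolev u u'" "x \<le> y"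
  shows "(u y - u x)\<^sup>2 \<le> (y - x) * (LBINT t. (u' t)\<^sup>2)"
proof -
  define D where "D = (LBINT t. (u' t)\<^sup>2)"
  have p: "primitive u u'" using assms by (simp add: sobolev_def)
  have "0 \<le> D" unfolding D_def by simp
  have *: "2 * \<bar>u y - u x\<bar> \<le> k * (y - x) + D / k" if "k > 0" for k
  proof -
    have "2 * \<bar>u' t\<bar> \<le> k + (u' t)\<^sup>2 / k" for t
    proof -
      have "0 \<le> (k - \<bar>u' t\<bar>)\<^sup>2 / k" using that by simp
      also have "\<dots> = k + (u' t)\<^sup>2 / k - 2 * \<bar>u' t\<bar>"
        using that by (simp add: power2_diff field_simps power2_eq_square)
      finally show ?thesis by simp
    qed
    then have pw: "\<bar>u' t\<bar> \<le> k / 2 + (u' t)\<^sup>2 / (2 * k)" for t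
      using that by (simp add: field_simps)
    have int: "set_integrable lborel {x<..y} (\<lambda>t. (u' t)\<^sup>2 / (2 * k))"
      using sobolev_integrable(2)[OF assms(1)] unfolding set_integrable_def
      by (intro integrable_mult_indicator) auto
    have "\<bar>u y - u x\<bar> \<le> (LBINT t:{x<..y}. \<bar>u' t\<bar>)"
      using set_integral_norm_bound[OF locally_integrableD(2)[OF primitiveD(1)[OF p]], of x y]
      unfolding primitiveD(2)[OF p assms(2)] by simp
    also have "\<dots> \<le> (LBINT t:{x<..y}. k / 2 + (u' t)\<^sup>2 / (2 * k))"
      using pw int assms(2) locally_integrableD(2)[OF primitiveD(1)[OF p], of x y]
      by (intro set_integral_mono set_integral_add set_integrable_abs) (auto simp: set_integrable_def)
    also have "\<dots> = k / 2 * (y - x) + (LBINT t:{x<..y}. (u' t)\<^sup>2 / (2 * k))"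
      using assms(2) int by (subst set_integral_add) (auto simp: set_integrable_def set_integral_const)
    also have "\<dots> \<le> k / 2 * (y - x) + (LBINT t. (u' t)\<^sup>2 / (2 * k))"
      using sobolev_integrable(2)[OF assms(1)] that by (intro add_left_mono set_integral_le_integral) auto
    also have "\<dots> = k / 2 * (y - x) + D / (2 * k)"
      by (simp add: D_def)
    finally show ?thesis by (simp add: field_simps)
  qed
  define d where "d = \<bar>u y - u x\<bar>"
  have "d\<^sup>2 \<le> (y - x) * D"
  proof (cases "d = 0 \<or> x = y")
    case True
    then show ?thesis using \<open>0 \<le> D\<close> assms(2) by (auto simp: d_def)
  next
    case False
    then have "d > 0" "y - x > 0" using assms(2) by (auto simp: d_def)
    moreover define e where "e = y - x"
    ultimately have "2 * d \<le> d / e * e + D / (d / e)" "d > 0" "e > 0"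
      using *[of "d / (y - x)"] by (auto simp: d_def)
    then have "d \<le> D * e / d" by simp
    then show ?thesis
      using \<open>d > 0\<close> by (simp add: e_def pos_le_divide_eq power2_eq_square mult.commute)
  qed
  then show ?thesis by (simp add: d_def D_def)
qed

text \<open>Average over \<open>y\<close> in \<open>{x..x + h}\<close> the inequality u(x)^2 <= 2
  u(y)^2 + 2 (u(y) - u(x))^2, whose last term \<open>sobolev_Hoelder\<close> controls.\<close>

lemma sobolev_sup_bound:
  fixes u :: "real \<Rightarrow> real"
  assumes "sobolev u u'" "h > 0"
  shows "(u x)\<^sup>2 \<le> 2 / h * (LBINT t. (u t)\<^sup>2) + 2 * h * (LBINT t. (u' t)\<^sup>2)"
proof -
  define D where "D = (LBINT t. (u' t)\<^sup>2)"
  have "0 \<le> D" unfolding D_def by simp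
  have pw: "(u x)\<^sup>2 \<le> 2 * (u y)\<^sup>2 + 2 * h * D" if "y \<in> {x..x + h}" for y
  proof -
    have "(u y - u x)\<^sup>2 \<le> (y - x) * D" using sobolev_Hoelder[OF assms(1), of x y] that by (simp add: D_def)
    also have "\<dots> \<le> h * D" using that \<open>0 \<le> D\<close> by (intro mult_right_mono) auto
    finally have "(u y - u x)\<^sup>2 \<le> h * D" .
    moreover have "0 \<le> (2 * u y - u x)\<^sup>2" by simp
    ultimately show ?thesis by (simp add: power2_eq_square algebra_simps)
  qed
  have int: "set_integrable lborel {x..x + h} (\<lambda>y. 2 * (u y)\<^sup>2)"
    using sobolev_integrable(1)[OF assms(1)] unfolding set_integrable_def
    by (intro integrable_mult_indicator) auto
  have const: "set_integrable lborel {x..x + h} (\<lambda>y. c)" for c :: real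
    using assms(2) by (auto simp: set_integrable_def)
  have "h * (u x)\<^sup>2 = (LBINT y:{x..x + h}. (u x)\<^sup>2)"
    using assms(2) by (simp add: set_integral_const)
  also have "\<dots> \<le> (LBINT y:{x..x + h}. 2 * (u y)\<^sup>2 + 2 * h * D)"
    using pw int const by (intro set_integral_mono set_integral_add) auto
  also have "\<dots> = (LBINT y:{x..x + h}. 2 * (u y)\<^sup>2) + h * (2 * h * D)"
    using assms(2) int const by (subst set_integral_add) (auto simp: set_integral_const)
  also have "\<dots> \<le> (LBINT y. 2 * (u y)\<^sup>2) + h * (2 * h * D)"
    using sobolev_integrable(1)[OF assms(1)] by (intro add_right_mono set_integral_le_integral) auto
  also have "\<dots> = h * (2 / h * (LBINT t. (u t)\<^sup>2) + 2 * h * D)"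
    using assms(2) by (simp add: field_simps)
  finally show ?thesis using assms(2) by (simp add: D_def)
qed

text \<open>The one-dimensional Gagliardo-Nirenberg bound up to lower order terms. In
  \<open>sobolev_sup_bound\<close> the width \<open>h = 1 / sqrt (D + 1)\<close> makes both terms of
  order \<open>sqrt D\<close>; the \<open>+ 1\<close> keeps it defined for
  \<open>D = 0\<close>.\<close>

lemma sobolev_sup_bound_quarter:
  fixes u :: "real \<Rightarrow> real"
  assumes "sobolev u u'"
  shows "\<bar>u x\<bar> \<le> sqrt (2 * ((LBINT t. (u t)\<^sup>2) + 1)) * ((LBINT t. (u' t)\<^sup>2) + 1) powr (1 / 4)"
proof -
  define D s where "D = (LBINT t. (u' t)\<^sup>2)" and "s = (LBINT t. (u t)\<^sup>2)"
  have "0 \<le> D" "0 \<le> s" unfolding D_def s_def by auto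
  define r where "r = sqrt (D + 1)"
  have r: "r > 0" "r * r = D + 1" using \<open>0 \<le> D\<close> by (auto simp: r_def)
  have "(u x)\<^sup>2 \<le> 2 * r * s + 2 * (1 / r) * D"
    using sobolev_sup_bound[OF assms, of "1 / r" x] r by (simp add: D_def s_def)
  also have "\<dots> \<le> 2 * (s + 1) * r"
    using r \<open>0 \<le> D\<close> by (simp add: field_simps)
  finally have "\<bar>u x\<bar> \<le> sqrt (2 * (s + 1) * r)"
    by (metis real_sqrt_abs real_sqrt_le_iff)
  also have "\<dots> = sqrt (2 * (s + 1)) * sqrt r" by (rule real_sqrt_mult)
  also have "sqrt r = (D + 1) powr (1 / 4)"
    using \<open>0 \<le> D\<close> by (simp add: r_def powr_half_sqrt[symmetric] powr_powr)
  finally show ?thesis by (simp add: D_def s_def)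
qed

lemma sobolev_of_real:
  assumes "sobolev u u'"
  shows "sobolev (\<lambda>x. complex_of_real (u x)) (\<lambda>x. complex_of_real (u' x))"
proof -
  have L2: "(\<lambda>x. complex_of_real (f x)) \<in> L2" if "f \<in> L2" for f
    using that by (auto simp: L2_def)
  have "complex_of_real (u y) - complex_of_real (u x) = (LBINT t:{x<..y}. complex_of_real (u' t))"
    if "x \<le> y" for x y
    using primitiveD(2)[of u u' x y] that assms
    by (simp add: sobolev_def set_lebesgue_integral_def scaleR_conv_of_real flip: of_real_diff of_real_mult)
  then show ?thesis
    using assms L2 L2_locally_integrable[OF L2[of u']] by (simp add: sobolev_def primitive_def)
qed

lemma sobolev_scale:
  fixes u :: "real \<Rightarrow> real"
  assumes "sobolev u u'"
  shows "sobolev (\<lambda>x. c * u x) (\<lambda>x. c * u' x)"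
proof -
  have L2: "(\<lambda>x. c * f x) \<in> L2" if "f \<in> L2" for f :: "real \<Rightarrow> real"
    using that by (auto simp: L2_def power_mult_distrib)
  have "c * u y - c * u x = (LBINT t:{x<..y}. c * u' t)" if "x \<le> y" for x y
    using primitiveD(2)[of u u' x y] that assms
    by (simp add: sobolev_def flip: right_diff_distrib)
  then show ?thesis
    using assms L2 L2_locally_integrable[OF L2[of u']] by (simp add: sobolev_def primitive_def)
qed

lemma sobolev_zero: "sobolev (\<lambda>x. 0) (\<lambda>x. 0)"
  by (auto simp: sobolev_def L2_def primitive_def locally_integrable_def set_integrable_def
      set_lebesgue_integral_def)

subsection \<open>Power inequalities\<close>

text \<open>Young's inequality with exponents \<open>\<theta>\<close> and
  \<open>1 - \<theta>\<close>. The constant \<open>B\<close> is chosen so that its power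
  \<open>1 - \<theta>\<close> supplies the factor \<open>C + 1\<close> and compensates the division
  of \<open>D + 1\<close> by 4; \<open>C + 1\<close> in place of \<open>C\<close> keeps
  \<open>B\<close> positive.\<close>

lemma powr_le_linear:
  fixes C \<theta> :: real
  assumes "0 < \<theta>" "\<theta> < 1" "0 \<le> C"
  obtains K where "\<And>D. 0 \<le> D \<Longrightarrow> C * (D + 1) powr \<theta> \<le> D / 4 + K"
proof -
  define B where "B = ((C + 1) * 4 powr \<theta>) powr (1 / (1 - \<theta>))"
  have B: "B > 0" "B powr (1 - \<theta>) = (C + 1) * 4 powr \<theta>"
    using assms by (auto simp: B_def powr_powr)
  have "C * (D + 1) powr \<theta> \<le> D / 4 + (1 + B)" if "0 \<le> D" for D
  proof -
    have "C * (D + 1) powr \<theta> \<le> (C + 1) * (D + 1) powr \<theta>"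
      by (simp add: mult_right_mono)
    also have "\<dots> = ((D + 1) / 4) powr \<theta> * B powr (1 - \<theta>)"
      using that by (simp add: B powr_divide)
    also have "\<dots> \<le> \<theta> * ((D + 1) / 4) + (1 - \<theta>) * B"
      using that assms B by (intro Youngs_inequality_0) auto
    also have "\<dots> \<le> 1 * ((D + 1) / 4) + 1 * B"
      using that assms B by (intro add_mono mult_right_mono) auto
    finally show ?thesis using that by (simp add: add_divide_distrib)
  qed
  then show thesis using that by blast
qed

lemma powr_split_square:
  fixes z r :: real
  assumes "0 \<le> z" "2 \<le> r"
  shows "z powr r = z\<^sup>2 * z powr (r - 2)"
  using assms by (cases "z = 0") (auto simp flip: powr_numeral powr_add)

text \<open>With \<open>c\<close> the hypotenuse, c^r = (a^2 + b^2) c^(r - 2), and \<open>c\<close>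
  dominates both legs.\<close>

lemma powr_sqrt_superadditive:
  fixes a b r :: real
  assumes "0 \<le> a" "0 \<le> b" "r \<ge> 2"
  shows "a powr r + b powr r \<le> sqrt (a\<^sup>2 + b\<^sup>2) powr r"
proof -
  define c where "c = sqrt (a\<^sup>2 + b\<^sup>2)"
  note split = powr_split_square[OF _ assms(3)]
  have c: "a \<le> c" "b \<le> c" "0 \<le> c" "c\<^sup>2 = a\<^sup>2 + b\<^sup>2"
    using assms by (auto simp: c_def intro: real_le_rsqrt)
  have "a powr r + b powr r \<le> a\<^sup>2 * c powr (r - 2) + b\<^sup>2 * c powr (r - 2)"
    using assms c by (auto simp: split intro!: add_mono mult_left_mono powr_mono2)
  also have "\<dots> = c powr r" using c by (simp add: split algebra_simps)
  finally show ?thesis by (simp add: c_def)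
qed

text \<open>The hypotenuse is at least \<open>sqrt 2\<close> times the shorter leg \<open>a\<close>,
  so in the proof of superadditivity the term of \<open>a\<close> gains the factor
  \<open>sqrt 2 powr (r - 2)\<close>. The longer leg need not gain anything.\<close>

lemma powr_sqrt_gap:
  fixes a b r m :: real
  assumes "0 < m" "m \<le> a" "m \<le> b" "r > 2"
  shows "a powr r + b powr r + (sqrt 2 powr (r - 2) - 1) * m powr r \<le> sqrt (a\<^sup>2 + b\<^sup>2) powr r"
  using assms
proof (induction a b rule: linorder_wlog)
  case (sym a b)
  then show ?case by (simp add: add.commute)
next
  case (le a b)
  define c where "c = sqrt (a\<^sup>2 + b\<^sup>2)"
  note split = powr_split_square[OF _ less_imp_le[OF \<open>r > 2\<close>]]
  have c: "b \<le> c" "0 \<le> c" "c\<^sup>2 = a\<^sup>2 + b\<^sup>2"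
    using le by (auto simp: c_def intro: real_le_rsqrt)
  have "a * sqrt 2 \<le> c"
    unfolding c_def using le power_mono[of a b 2] by (intro real_le_rsqrt) (simp add: power_mult_distrib)
  then have "(a * sqrt 2) powr (r - 2) \<le> c powr (r - 2)"
    using le by (intro powr_mono2) auto
  then have "a\<^sup>2 * (a powr (r - 2) * sqrt 2 powr (r - 2)) \<le> a\<^sup>2 * c powr (r - 2)"
    using le by (intro mult_left_mono) (auto simp: powr_mult)
  then have 1: "a powr r * sqrt 2 powr (r - 2) \<le> a\<^sup>2 * c powr (r - 2)"
    using le by (simp add: split mult.assoc)
  have 2: "b powr r \<le> b\<^sup>2 * c powr (r - 2)"
    using le c by (auto simp: split intro!: mult_left_mono powr_mono2)
  have "1 \<le> sqrt 2 powr (r - 2)" using le by (intro ge_one_powr_ge_zero) auto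
  then have 3: "(sqrt 2 powr (r - 2) - 1) * m powr r \<le> (sqrt 2 powr (r - 2) - 1) * a powr r"
    using le by (intro mult_left_mono powr_mono2) auto
  have "c powr r = a\<^sup>2 * c powr (r - 2) + b\<^sup>2 * c powr (r - 2)"
    using c by (simp add: split algebra_simps)
  then show ?case using 1 2 3 by (simp add: c_def algebra_simps)
qed

lemma cross_superadditive:
  assumes "0 \<le> b1" "0 \<le> (b2::real)"
  shows "a1\<^sup>2 * b1 + a2\<^sup>2 * b2 \<le> (a1\<^sup>2 + a2\<^sup>2) * sqrt (b1\<^sup>2 + b2\<^sup>2)"
proof -
  have "b1 \<le> sqrt (b1\<^sup>2 + b2\<^sup>2)" "b2 \<le> sqrt (b1\<^sup>2 + b2\<^sup>2)" by (auto intro: real_le_rsqrt)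
  then have "a1\<^sup>2 * b1 + a2\<^sup>2 * b2 \<le> a1\<^sup>2 * sqrt (b1\<^sup>2 + b2\<^sup>2) + a2\<^sup>2 * sqrt (b1\<^sup>2 + b2\<^sup>2)"
    by (intro add_mono mult_left_mono) auto
  then show ?thesis by (simp add: distrib_right)
qed

subsection \<open>Wide tents and peaks\<close>

text \<open>The derivative is obtained from the Lipschitz constant \<open>1 / L\<close> on the
  support. The mass is 2 L / 3; only its order in \<open>L\<close> matters below, hence the crude
  bounds by indicators.\<close>

lemma sobolev_tent:
  assumes "L > 0"
  obtains w' where "sobolev (\<lambda>x. max 0 (1 - \<bar>x\<bar> / L)) w'" "(LBINT x. (w' x)\<^sup>2) \<le> 2 / L"
    "L / 4 \<le> (LBINT x. (max 0 (1 - \<bar>x\<bar> / L))\<^sup>2)" "(LBINT x. (max 0 (1 - \<bar>x\<bar> / L))\<^sup>2) \<le> 2 * L"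
proof -
  define w where "w x = max 0 (1 - \<bar>x\<bar> / L)" for x
  define G where "G x = indicator {- L..L} x / L" for x :: real
  have G_int: "integrable lborel G" unfolding G_def using assms by simp
  have G: "locally_integrable G" "0 \<le> G x" for x
    using integrable_mult_indicator[OF _ G_int] assms
    by (auto simp: locally_integrable_def set_integrable_def G_def)
  have w_le: "0 \<le> w x" "w x \<le> indicator {- L..L} x" for x
    using assms by (auto simp: w_def indicator_def field_simps)
  have inc: "\<bar>w y - w x\<bar> \<le> (LBINT t:{x<..y}. G t)" if "x \<le> y" for x y
  proof (cases "y \<le> - L \<or> L \<le> x")
    case True
    then have "w x = 0" "w y = 0" using that assms by (auto simp: w_def field_simps)
    then show ?thesis using G(2) by (simp add: set_lebesgue_integral_def)
  next
    case False
    \<comment> \<open>The tent vanishes outside the support, so both points may be moved to the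
      nearest point of \<open>{- L..L}\<close> without changing its values.\<close>
    then have le: "max x (- L) \<le> min y L" using that assms by auto
    have lip: "\<bar>w b - w a\<bar> \<le> (b - a) / L" if "a \<le> b" for a b
    proof -
      have "\<bar>w b - w a\<bar> \<le> \<bar>(\<bar>a\<bar> - \<bar>b\<bar>) / L\<bar>"
        unfolding w_def diff_divide_distrib by (auto simp: max_def)
      also have "\<dots> = \<bar>\<bar>a\<bar> - \<bar>b\<bar>\<bar> / L" using assms by simp
      also have "\<dots> \<le> (b - a) / L" using that assms by (intro divide_right_mono) auto
      finally show ?thesis .
    qed
    have "w x = w (max x (- L))" "w y = w (min y L)"
      using assms by (auto simp: w_def max_def min_def field_simps abs_if)
    then have "\<bar>w y - w x\<bar> \<le> (min y L - max x (- L)) / L" using lip[OF le] by simp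
    also have "\<dots> = (LBINT t. indicator {max x (- L)<..min y L} t / L)"
      using le by simp
    also have "\<dots> \<le> (LBINT t:{x<..y}. G t)"
      unfolding set_lebesgue_integral_def
    proof (rule integral_mono)
      show "integrable lborel (\<lambda>t. indicator {max x (- L)<..min y L} t / L)" using le by simp
      show "integrable lborel (\<lambda>t. indicator {x<..y} t *\<^sub>R G t)"
        by (rule integrable_mult_indicator[OF _ G_int]) simp
      show "indicator {max x (- L)<..min y L} t / L \<le> indicator {x<..y} t *\<^sub>R G t" for t
        using assms by (auto simp: G_def indicator_def)
    qed
    finally show ?thesis .
  qed
  obtain w' where w': "primitive w w'" "AE x in lborel. \<bar>w' x\<bar> \<le> G x"
    using primitive_of_increment_bound[OF G(1,2) inc] by blast
  have [measurable]: "w' \<in> borel_measurable borel"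
    by (rule locally_integrable_measurable[OF primitiveD(1)[OF w'(1)]])
  have wm [measurable]: "w \<in> borel_measurable borel" by (rule primitive_measurable[OF w'(1)])
  have ind: "integrable lborel (\<lambda>x. indicator {- L..L} x / L\<^sup>2)" "integrable lborel (indicator {- L..L} :: real \<Rightarrow> real)"
    using assms by simp_all
  have w'2: "AE x in lborel. (w' x)\<^sup>2 \<le> indicator {- L..L} x / L\<^sup>2"
    using w'(2)
  proof eventually_elim
    case (elim x)
    then have "\<bar>w' x\<bar>\<^sup>2 \<le> (G x)\<^sup>2" by (intro power_mono) auto
    then show ?case by (auto simp: G_def indicator_def power_divide split: if_splits)
  qed
  have w2: "(w x)\<^sup>2 \<le> indicator {- L..L} x" for x
    using power_mono[OF w_le(2)[of x] w_le(1)[of x], of 2] by (auto simp: indicator_def split: if_splits)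
  have int: "integrable lborel (\<lambda>x. (w x)\<^sup>2)" "integrable lborel (\<lambda>x. (w' x)\<^sup>2)"
  proof -
    show "integrable lborel (\<lambda>x. (w x)\<^sup>2)"
      by (rule Bochner_Integration.integrable_bound[OF ind(2)]) (use w2 in auto)
    show "integrable lborel (\<lambda>x. (w' x)\<^sup>2)"
      by (rule Bochner_Integration.integrable_bound[OF ind(1)]) (use w'2 in auto)
  qed
  have "sobolev w w'"
    using int w'(1) by (simp add: sobolev_def L2_def)
  moreover have "(LBINT x. (w' x)\<^sup>2) \<le> 2 / L"
  proof -
    have "(LBINT x. (w' x)\<^sup>2) \<le> (LBINT x. indicator {- L..L} x / L\<^sup>2)"
      by (intro integral_mono_AE int ind w'2)
    then show ?thesis using assms by (simp add: power2_eq_square)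
  qed
  moreover have "(LBINT x. (w x)\<^sup>2) \<le> 2 * L"
  proof -
    have "(LBINT x. (w x)\<^sup>2) \<le> (LBINT x. indicator {- L..L} x)"
      by (intro integral_mono int ind w2)
    then show ?thesis using assms by simp
  qed
  moreover have "L / 4 \<le> (LBINT x. (w x)\<^sup>2)"
  proof -
    have "indicator {- L / 2..L / 2} x / 4 \<le> (w x)\<^sup>2" for x
    proof (cases "x \<in> {- L / 2..L / 2}")
      case True
      then have "1 / 2 \<le> w x" using assms by (auto simp: w_def field_simps max_def)
      then have "(1 / 2)\<^sup>2 \<le> (w x)\<^sup>2" by (intro power_mono) auto
      then show ?thesis using True by (simp add: power2_eq_square)
    qed simp
    then have "(LBINT x. indicator {- L / 2..L / 2} x / 4) \<le> (LBINT x. (w x)\<^sup>2)"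
      using assms by (intro integral_mono int) auto
    then show ?thesis using assms by simp
  qed
  ultimately show thesis using that unfolding w_def by blast
qed

text \<open>A tent rescaled to mass \<open>s\<close>. Its kinetic energy decays like L^-2 but its
  squared height only like 1 / L: for large \<open>L\<close> this disparity yields both
  \<open>I_0_neg\<close> and strictness when a minimising sequence may vanish.\<close>

lemma sobolev_wide_bump:
  assumes "L > 0" "s \<ge> 0"
  obtains u u' where "sobolev u u'" "\<And>x. 0 \<le> u x" "(LBINT x. (u x)\<^sup>2) = s"
    "(LBINT x. (u' x)\<^sup>2) \<le> 8 * s / L\<^sup>2" "\<And>x. \<bar>x\<bar> \<le> L / 2 \<Longrightarrow> s / (8 * L) \<le> (u x)\<^sup>2"
proof -
  define w where "w x = max 0 (1 - \<bar>x\<bar> / L)" for x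
  define m where "m = (LBINT x. (w x)\<^sup>2)"
  obtain w' where w': "sobolev w w'" "(LBINT x. (w' x)\<^sup>2) \<le> 2 / L" "L / 4 \<le> m" "m \<le> 2 * L"
    using sobolev_tent[OF assms(1)] unfolding w_def m_def by blast
  have "m > 0" using w'(3) assms(1) by linarith
  have c2: "(sqrt (s / m))\<^sup>2 = s / m" using assms \<open>m > 0\<close> by simp
  show thesis
  proof (rule that[OF sobolev_scale[OF w'(1), of "sqrt (s / m)"]])
    show "0 \<le> sqrt (s / m) * w x" for x using assms \<open>m > 0\<close> by (simp add: w_def)
    show "(LBINT x. (sqrt (s / m) * w x)\<^sup>2) = s"
      using \<open>m > 0\<close> by (simp add: power_mult_distrib c2 flip: m_def)
    have "(LBINT x. (sqrt (s / m) * w' x)\<^sup>2) = s / m * (LBINT x. (w' x)\<^sup>2)"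
      by (simp add: power_mult_distrib c2)
    also have "\<dots> \<le> s / (L / 4) * (2 / L)"
      using w' assms \<open>m > 0\<close> by (intro mult_mono divide_left_mono) auto
    finally show "(LBINT x. (sqrt (s / m) * w' x)\<^sup>2) \<le> 8 * s / L\<^sup>2"
      by (simp add: power2_eq_square)
    show "s / (8 * L) \<le> (sqrt (s / m) * w x)\<^sup>2" if "\<bar>x\<bar> \<le> L / 2" for x
    proof -
      have "1 / 2 \<le> w x" using that assms by (auto simp: w_def field_simps max_def)
      then have "(1 / 2)\<^sup>2 \<le> (w x)\<^sup>2" by (intro power_mono) auto
      then have "s / (2 * L) * (1 / 2)\<^sup>2 \<le> s / m * (w x)\<^sup>2"
        using w' assms \<open>m > 0\<close> by (intro mult_mono divide_left_mono) auto
      then show ?thesis by (simp add: power_mult_distrib c2 power_divide)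
    qed
  qed
qed

text \<open>Over a distance \<open>l\<close> the function moves by at most
  \<open>sqrt (l * C)\<close>, that is, by at most half of \<open>m\<close>.\<close>

lemma sobolev_peak_persists:
  fixes u :: "real \<Rightarrow> real"
  assumes "sobolev u u'" "(LBINT t. (u' t)\<^sup>2) \<le> C" "m < u 0" "\<bar>x\<bar> \<le> l" "l * C \<le> (m / 2)\<^sup>2" "m > 0"
  shows "m / 2 \<le> u x"
proof -
  have "(u x - u 0)\<^sup>2 \<le> \<bar>x\<bar> * (LBINT t. (u' t)\<^sup>2)"
    using sobolev_Hoelder[OF assms(1), of 0 x] sobolev_Hoelder[OF assms(1), of x 0]
    by (cases "0 \<le> x") (auto simp: power2_commute)
  also have "\<dots> \<le> l * C" using assms by (intro mult_mono) auto
  finally have "(u x - u 0)\<^sup>2 \<le> (m / 2)\<^sup>2" using assms by linarith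
  then have "\<bar>u x - u 0\<bar> \<le> m / 2" using assms by (metis abs_le_square_iff abs_of_pos half_gt_zero)
  then show ?thesis using assms(3) by linarith
qed

lemma sobolev_powr_integral:
  fixes u :: "real \<Rightarrow> real"
  assumes "sobolev u u'" "\<And>x. 0 \<le> u x" "\<And>x. u x \<le> M" "2 \<le> r"
  shows "integrable lborel (\<lambda>x. u x powr r)"
    "(LBINT x. u x powr r) \<le> M powr (r - 2) * (LBINT x. (u x)\<^sup>2)"
proof -
  note [measurable] = sobolev_measurable(1)[OF assms(1)]
  have le: "u x powr r \<le> M powr (r - 2) * (u x)\<^sup>2" for x
    unfolding powr_split_square[OF assms(2,4)] mult.commute[of "(u x)\<^sup>2"]
    using assms by (intro mult_right_mono powr_mono2) auto
  have int: "integrable lborel (\<lambda>x. M powr (r - 2) * (u x)\<^sup>2)"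
    using sobolev_integrable(1)[OF assms(1)] by simp
  show *: "integrable lborel (\<lambda>x. u x powr r)"
    by (rule Bochner_Integration.integrable_bound[OF int]) (use le in auto)
  show "(LBINT x. u x powr r) \<le> M powr (r - 2) * (LBINT x. (u x)\<^sup>2)"
    using integral_mono[OF * int le] by simp
qed

lemma sobolev_product_integral:
  fixes u :: "real \<Rightarrow> real"
  assumes "sobolev u u'" "v \<in> borel_measurable borel" "\<And>x. \<bar>v x\<bar> \<le> M"
  shows "integrable lborel (\<lambda>x. (u x)\<^sup>2 * v x)"
    "(LBINT x. (u x)\<^sup>2 * v x) \<le> M * (LBINT x. (u x)\<^sup>2)"
proof -
  note [measurable] = sobolev_measurable(1)[OF assms(1)] assms(2)
  have le: "\<bar>(u x)\<^sup>2 * v x\<bar> \<le> M * (u x)\<^sup>2" for x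
    using mult_left_mono[OF assms(3)[of x], of "(u x)\<^sup>2"] by (simp add: abs_mult mult.commute)
  have int: "integrable lborel (\<lambda>x. M * (u x)\<^sup>2)"
    using sobolev_integrable(1)[OF assms(1)] by simp
  show *: "integrable lborel (\<lambda>x. (u x)\<^sup>2 * v x)"
    by (rule Bochner_Integration.integrable_bound[OF int]) (use le in \<open>auto intro: order_trans[OF _ abs_ge_self]\<close>)
  show "(LBINT x. (u x)\<^sup>2 * v x) \<le> M * (LBINT x. (u x)\<^sup>2)"
    using integral_mono[OF * int] le by (force simp: abs_le_iff)
qed

subsection \<open>The variational problem\<close>

text \<open>Two facts are needed about the odd root: it agrees with \<open>powr\<close> on
  nonnegative arguments, and its size at negative ones is that of the modulus. So replacing
  \<open>v\<close> by its modulus cannot raise the energy.\<close>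

lemma odd_power_powr:
  assumes "0 < r"
  shows "\<bar>odd_power x r\<bar> = \<bar>x\<bar> powr of_rat r"
    and "0 \<le> x \<Longrightarrow> odd_power x r = x powr of_rat r"
    and "(\<lambda>x. odd_power x r) \<in> borel_measurable borel"
proof -
  obtain m n where mn: "quotient_of r = (m, n)" by (cases "quotient_of r")
  have n: "0 < n" using quotient_of_denom_pos[OF mn] .
  have r: "r = of_int m / of_int n" using quotient_of_div[OF mn] .
  have m: "0 < m" using assms n by (simp add: r zero_less_divide_iff)
  have eq: "odd_power y r = root (nat n) y ^ nat m" for y
    using m by (simp add: odd_power_def mn power_int_def)
  have pos: "odd_power y r = y powr of_rat r" if "0 \<le> y" for y
  proof (cases "y = 0")
    case False
    then have "root (nat n) y = y powr (1 / real (nat n))"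
      using that n by (simp add: root_powr_inverse)
    then have "odd_power y r = (y powr (1 / real (nat n))) powr real (nat m)"
      using that False by (simp add: eq powr_realpow)
    then show ?thesis
      using m n by (simp add: powr_powr r of_rat_divide)
  qed (use m in \<open>simp add: eq\<close>)
  show "\<bar>odd_power x r\<bar> = \<bar>x\<bar> powr of_rat r"
    using pos[of "\<bar>x\<bar>"] n by (simp add: eq power_abs flip: real_root_abs)
  show "0 \<le> x \<Longrightarrow> odd_power x r = x powr of_rat r" by (rule pos)
  show "(\<lambda>x. odd_power x r) \<in> borel_measurable borel"
    unfolding eq by (intro borel_measurable_continuous_onI continuous_intros)
qed

text \<open>The exponent \<open>p\<close> is real here: for nonnegative \<open>v\<close> the power
  is plain \<open>powr\<close>, and the rational exponent returns only when the infimum is compared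
  with \<open>min_energy\<close>.\<close>

locale nls_kdv =
  fixes \<alpha> \<beta>1 \<beta>2 q p :: real
  assumes \<alpha>: "\<alpha> > 0" and \<beta>1: "\<beta>1 \<ge> 0" and \<beta>2: "\<beta>2 > 0"
    and q: "1 \<le> q" "q < 4" and p: "1 \<le> p" "p < 4"
begin

definition pot :: "real \<Rightarrow> real \<Rightarrow> real" where
  "pot a b = \<beta>1 * a powr (q + 2) + \<beta>2 * b powr (p + 2) + \<alpha> * (a\<^sup>2 * b)"

definition J :: "(real \<Rightarrow> real) \<Rightarrow> (real \<Rightarrow> real) \<Rightarrow> (real \<Rightarrow> real) \<Rightarrow> (real \<Rightarrow> real) \<Rightarrow> real" where
  "J u u' v v' = (LBINT x. (u' x)\<^sup>2 + (v' x)\<^sup>2 - pot (u x) (v x))"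

text \<open>Minimisation may be restricted to nonnegative real-valued pairs, represented by continuous
  functions together with their derivatives; this loses nothing because replacing a function by its
  modulus does not increase the energy.\<close>

definition adm ::
  "real \<Rightarrow> real \<Rightarrow> (real \<Rightarrow> real) \<Rightarrow> (real \<Rightarrow> real) \<Rightarrow> (real \<Rightarrow> real) \<Rightarrow> (real \<Rightarrow> real) \<Rightarrow> bool" where
  "adm s t u u' v v' \<longleftrightarrow> sobolev u u' \<and> sobolev v v' \<and> (\<forall>x. 0 \<le> u x \<and> 0 \<le> v x) \<and>
     (LBINT x. (u x)\<^sup>2) = s \<and> (LBINT x. (v x)\<^sup>2) = t"

text \<open>A real infimum, so it is meaningful only once the set is known to be nonempty
  (\<open>adm_exists\<close>) and bounded below (\<open>bdd_below_J\<close>).\<close>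

definition I :: "real \<Rightarrow> real \<Rightarrow> real" where
  "I s t = Inf {J u u' v v' | u u' v v'. adm s t u u' v v'}"

lemma admD:
  assumes "adm s t u u' v v'"
  shows "sobolev u u'" "sobolev v v'" "0 \<le> u x" "0 \<le> v x"
    "(LBINT x. (u x)\<^sup>2) = s" "(LBINT x. (v x)\<^sup>2) = t" "0 \<le> s" "0 \<le> t"
  using assms by (auto simp: adm_def)

lemma sup_bound_exists:
  fixes u :: "real \<Rightarrow> real"
  assumes "sobolev u u'"
  obtains M where "\<And>x. \<bar>u x\<bar> \<le> M"
  using sobolev_sup_bound_quarter[OF assms] by blast

lemma adm_integrable:
  assumes "adm s t u u' v v'"
  shows "integrable lborel (\<lambda>x. u x powr (q + 2))" "integrable lborel (\<lambda>x. v x powr (p + 2))"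
    "integrable lborel (\<lambda>x. (u x)\<^sup>2 * v x)" "integrable lborel (\<lambda>x. pot (u x) (v x))"
    "integrable lborel (\<lambda>x. (u' x)\<^sup>2 + (v' x)\<^sup>2 - pot (u x) (v x))"
proof -
  note a = admD[OF assms]
  obtain M where M: "\<And>x. \<bar>u x\<bar> \<le> M" using sup_bound_exists[OF a(1)] by blast
  obtain N where N: "\<And>x. \<bar>v x\<bar> \<le> N" using sup_bound_exists[OF a(2)] by blast
  show 1: "integrable lborel (\<lambda>x. u x powr (q + 2))"
    using sobolev_powr_integral(1)[OF a(1) a(3), of M "q + 2"] M q by (simp add: abs_le_iff)
  show 2: "integrable lborel (\<lambda>x. v x powr (p + 2))"
    using sobolev_powr_integral(1)[OF a(2) a(4), of N "p + 2"] N p by (simp add: abs_le_iff)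
  show 3: "integrable lborel (\<lambda>x. (u x)\<^sup>2 * v x)"
    by (rule sobolev_product_integral(1)[OF a(1) sobolev_measurable(1)[OF a(2)] N])
  show "integrable lborel (\<lambda>x. pot (u x) (v x))"
    unfolding pot_def using 1 2 3 by simp
  then show "integrable lborel (\<lambda>x. (u' x)\<^sup>2 + (v' x)\<^sup>2 - pot (u x) (v x))"
    using sobolev_integrable(2)[OF a(1)] sobolev_integrable(2)[OF a(2)] by simp
qed

section \<open>Coercivity and finiteness of the infimum\<close>

lemma J_split:
  assumes "adm s t u u' v v'"
  shows "J u u' v v' = (LBINT x. (u' x)\<^sup>2) + (LBINT x. (v' x)\<^sup>2) - \<beta>1 * (LBINT x. u x powr (q + 2))
     - \<beta>2 * (LBINT x. v x powr (p + 2)) - \<alpha> * (LBINT x. (u x)\<^sup>2 * v x)"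
  using adm_integrable[OF assms] sobolev_integrable(2)[OF admD(1)[OF assms]]
    sobolev_integrable(2)[OF admD(2)[OF assms]]
  unfolding J_def pot_def by simp

text \<open>Two powers of each integrand give a mass, the rest is bounded by the sup norm; this
  leaves the orders \<open>q / 4\<close>, \<open>p / 4\<close> and \<open>1 / 4\<close> in the
  kinetic energies, all below 1. \<open>powr_le_linear\<close> absorbs each term into a quarter:
  \<open>D1\<close> is charged once, \<open>D2\<close> for its own power and for the coupling, so
  half of the kinetic energy survives.\<close>

lemma coercive:
  assumes "0 \<le> s" "0 \<le> t"
  obtains K where "\<And>u u' v v'. adm s t u u' v v' \<Longrightarrow>
    ((LBINT x. (u' x)\<^sup>2) + (LBINT x. (v' x)\<^sup>2)) / 2 - K \<le> J u u' v v'"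
proof -
  define A B where "A = sqrt (2 * (s + 1))" and "B = sqrt (2 * (t + 1))"
  have AB: "0 \<le> A" "0 \<le> B" using assms by (auto simp: A_def B_def)
  obtain K1 where K1: "\<And>D. 0 \<le> D \<Longrightarrow> (\<beta>1 * (A powr q * s)) * (D + 1) powr (q / 4) \<le> D / 4 + K1"
    using powr_le_linear[of "q / 4" "\<beta>1 * (A powr q * s)"] q \<beta>1 assms by auto
  obtain K2 where K2: "\<And>D. 0 \<le> D \<Longrightarrow> (\<beta>2 * (B powr p * t)) * (D + 1) powr (p / 4) \<le> D / 4 + K2"
    using powr_le_linear[of "p / 4" "\<beta>2 * (B powr p * t)"] p \<beta>2 assms by auto
  obtain K3 where K3: "\<And>D. 0 \<le> D \<Longrightarrow> (\<alpha> * (B * s)) * (D + 1) powr (1 / 4) \<le> D / 4 + K3"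
    using powr_le_linear[of "1 / 4" "\<alpha> * (B * s)"] \<alpha> AB assms by auto
  show thesis
  proof (rule that[of "K1 + K2 + K3"])
    fix u u' v v' assume adm: "adm s t u u' v v'"
    note a = admD[OF adm]
    define D1 D2 where "D1 = (LBINT x. (u' x)\<^sup>2)" and "D2 = (LBINT x. (v' x)\<^sup>2)"
    have D: "0 \<le> D1" "0 \<le> D2" by (auto simp: D1_def D2_def)
    have M: "u x \<le> A * (D1 + 1) powr (1 / 4)" "\<bar>v x\<bar> \<le> B * (D2 + 1) powr (1 / 4)" for x
      using sobolev_sup_bound_quarter[OF a(1), of x] sobolev_sup_bound_quarter[OF a(2), of x]
      by (auto simp: a A_def B_def D1_def D2_def)
    have "\<beta>1 * (LBINT x. u x powr (q + 2)) \<le> \<beta>1 * ((A * (D1 + 1) powr (1 / 4)) powr q * s)"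
      using sobolev_powr_integral(2)[OF a(1,3) M(1), of "q + 2"] q \<beta>1 by (intro mult_left_mono) (auto simp: a)
    also have "\<dots> = (\<beta>1 * (A powr q * s)) * (D1 + 1) powr (q / 4)"
      using AB by (simp add: powr_mult powr_powr)
    also have "\<dots> \<le> D1 / 4 + K1" by (rule K1[OF D(1)])
    finally have 1: "\<beta>1 * (LBINT x. u x powr (q + 2)) \<le> D1 / 4 + K1" .
    have "v x \<le> B * (D2 + 1) powr (1 / 4)" for x using M(2)[of x] by simp
    then have "\<beta>2 * (LBINT x. v x powr (p + 2)) \<le> \<beta>2 * ((B * (D2 + 1) powr (1 / 4)) powr p * t)"
      using sobolev_powr_integral(2)[OF a(2,4), of "B * (D2 + 1) powr (1 / 4)" "p + 2"] p \<beta>2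
      by (intro mult_left_mono) (auto simp: a)
    also have "\<dots> = (\<beta>2 * (B powr p * t)) * (D2 + 1) powr (p / 4)"
      using AB by (simp add: powr_mult powr_powr)
    also have "\<dots> \<le> D2 / 4 + K2" by (rule K2[OF D(2)])
    finally have 2: "\<beta>2 * (LBINT x. v x powr (p + 2)) \<le> D2 / 4 + K2" .
    have "\<alpha> * (LBINT x. (u x)\<^sup>2 * v x) \<le> \<alpha> * (B * (D2 + 1) powr (1 / 4) * s)"
      using sobolev_product_integral(2)[OF a(1) sobolev_measurable(1)[OF a(2)] M(2)] \<alpha>
      by (intro mult_left_mono) (auto simp: a)
    also have "\<dots> = (\<alpha> * (B * s)) * (D2 + 1) powr (1 / 4)" by simp
    also have "\<dots> \<le> D2 / 4 + K3" by (rule K3[OF D(2)])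
    finally have 3: "\<alpha> * (LBINT x. (u x)\<^sup>2 * v x) \<le> D2 / 4 + K3" .
    have "(D1 + D2) / 2 - (K1 + K2 + K3) \<le> J u u' v v'"
      using 1 2 3 D unfolding J_split[OF adm] D1_def[symmetric] D2_def[symmetric] by (simp add: field_simps)
    then show "((LBINT x. (u' x)\<^sup>2) + (LBINT x. (v' x)\<^sup>2)) / 2 - (K1 + K2 + K3) \<le> J u u' v v'"
      by (simp add: D1_def D2_def)
  qed
qed

lemma bdd_below_J:
  assumes "0 \<le> s" "0 \<le> t"
  shows "bdd_below {J u u' v v' | u u' v v'. adm s t u u' v v'}"
proof -
  obtain K where K: "\<And>u u' v v'. adm s t u u' v v' \<Longrightarrow>
    ((LBINT x. (u' x)\<^sup>2) + (LBINT x. (v' x)\<^sup>2)) / 2 - K \<le> J u u' v v'"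
    using coercive[OF assms] by blast
  show ?thesis
  proof (rule bdd_belowI[of _ "- K"])
    fix z assume "z \<in> {J u u' v v' | u u' v v'. adm s t u u' v v'}"
    then obtain u u' v v' where z: "z = J u u' v v'" "adm s t u u' v v'" by blast
    define D where "D = (LBINT x. (u' x)\<^sup>2) + (LBINT x. (v' x)\<^sup>2)"
    have "0 \<le> D" by (simp add: D_def)
    moreover have "D / 2 - K \<le> z" using K[OF z(2)] by (simp add: D_def z(1))
    ultimately show "- K \<le> z" by simp
  qed
qed

lemma I_le:
  assumes "adm s t u u' v v'"
  shows "I s t \<le> J u u' v v'"
  unfolding I_def using assms admD(7,8)[OF assms] by (intro cInf_lower bdd_below_J) auto

lemma adm_exists:
  assumes "0 \<le> s" "0 \<le> t"
  shows "\<exists>u u' v v'. adm s t u u' v v'"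
proof -
  obtain u u' where "sobolev u u'" "\<And>x. 0 \<le> u x" "(LBINT x. (u x)\<^sup>2) = s"
    using sobolev_wide_bump[of 1 s] assms by (metis zero_less_one)
  moreover obtain v v' where "sobolev v v'" "\<And>x. 0 \<le> v x" "(LBINT x. (v x)\<^sup>2) = t"
    using sobolev_wide_bump[of 1 t] assms by (metis zero_less_one)
  ultimately show ?thesis unfolding adm_def by blast
qed

lemma I_approx:
  assumes "0 \<le> s" "0 \<le> t" "0 < \<epsilon>"
  obtains u u' v v' where "adm s t u u' v v'" "J u u' v v' < I s t + \<epsilon>"
proof -
  have "{J u u' v v' | u u' v v'. adm s t u u' v v'} \<noteq> {}"
    using adm_exists[OF assms(1,2)] by blast
  then have "\<exists>z\<in>{J u u' v v' | u u' v v'. adm s t u u' v v'}. z < I s t + \<epsilon>"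
    using assms cInf_lessD[of "{J u u' v v' | u u' v v'. adm s t u u' v v'}" "I s t + \<epsilon>"]
    by (auto simp: I_def)
  then show thesis using that by blast
qed

section \<open>Superposition of two pairs\<close>

lemma pot_superadditive:
  assumes "0 \<le> a1" "0 \<le> a2" "0 \<le> b1" "0 \<le> b2"
  shows "pot a1 b1 + pot a2 b2 \<le> pot (sqrt (a1\<^sup>2 + a2\<^sup>2)) (sqrt (b1\<^sup>2 + b2\<^sup>2))"
proof -
  have "\<beta>1 * (a1 powr (q + 2) + a2 powr (q + 2)) \<le> \<beta>1 * sqrt (a1\<^sup>2 + a2\<^sup>2) powr (q + 2)"
    using assms q \<beta>1 by (intro mult_left_mono powr_sqrt_superadditive) auto
  moreover have "\<beta>2 * (b1 powr (p + 2) + b2 powr (p + 2)) \<le> \<beta>2 * sqrt (b1\<^sup>2 + b2\<^sup>2) powr (p + 2)"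
    using assms p \<beta>2 by (intro mult_left_mono powr_sqrt_superadditive) auto
  moreover have "\<alpha> * (a1\<^sup>2 * b1 + a2\<^sup>2 * b2) \<le> \<alpha> * ((a1\<^sup>2 + a2\<^sup>2) * sqrt (b1\<^sup>2 + b2\<^sup>2))"
    using assms \<alpha> by (intro mult_left_mono cross_superadditive) auto
  ultimately show ?thesis by (simp add: pot_def distrib_left)
qed

lemma pot_gap_v:
  assumes "0 \<le> a1" "0 \<le> a2" "0 < m" "m \<le> b1" "m \<le> b2"
  shows "pot a1 b1 + pot a2 b2 + \<beta>2 * ((sqrt 2 powr p - 1) * m powr (p + 2))
    \<le> pot (sqrt (a1\<^sup>2 + a2\<^sup>2)) (sqrt (b1\<^sup>2 + b2\<^sup>2))"
proof -
  have "\<beta>1 * (a1 powr (q + 2) + a2 powr (q + 2)) \<le> \<beta>1 * sqrt (a1\<^sup>2 + a2\<^sup>2) powr (q + 2)"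
    using assms q \<beta>1 by (intro mult_left_mono powr_sqrt_superadditive) auto
  moreover have "\<beta>2 * (b1 powr (p + 2) + b2 powr (p + 2) + (sqrt 2 powr p - 1) * m powr (p + 2))
      \<le> \<beta>2 * sqrt (b1\<^sup>2 + b2\<^sup>2) powr (p + 2)"
    using powr_sqrt_gap[of m b1 b2 "p + 2"] assms p \<beta>2 by (intro mult_left_mono) auto
  moreover have "\<alpha> * (a1\<^sup>2 * b1 + a2\<^sup>2 * b2) \<le> \<alpha> * ((a1\<^sup>2 + a2\<^sup>2) * sqrt (b1\<^sup>2 + b2\<^sup>2))"
    using assms \<alpha> by (intro mult_left_mono cross_superadditive) auto
  ultimately show ?thesis by (simp add: pot_def distrib_left)
qed

text \<open>If the second pair has no \<open>v\<close> component, its \<open>u\<close> mass still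
  couples to the \<open>v\<close> component of the first: \<open>a2\<^sup>2 * b1\<close> appears in
  the superposition and in neither pair alone.\<close>

lemma pot_gap_u:
  assumes "0 \<le> a1" "0 \<le> a2" "0 \<le> b1"
  shows "pot a1 b1 + pot a2 0 + \<alpha> * (a2\<^sup>2 * b1) \<le> pot (sqrt (a1\<^sup>2 + a2\<^sup>2)) (sqrt (b1\<^sup>2 + 0\<^sup>2))"
proof -
  have "\<beta>1 * (a1 powr (q + 2) + a2 powr (q + 2)) \<le> \<beta>1 * sqrt (a1\<^sup>2 + a2\<^sup>2) powr (q + 2)"
    using assms q \<beta>1 by (intro mult_left_mono powr_sqrt_superadditive) auto
  then show ?thesis using assms by (simp add: pot_def algebra_simps)
qed

text \<open>The superposition is the Euclidean norm of a curve in the plane, so its squared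
  derivative is at most the sum of the two squared derivatives. A pointwise gain
  \<open>\<kappa>\<close> on an interval of length \<open>2 * l\<close> is passed on to the
  infimum.\<close>

lemma I_superposition:
  assumes adm1: "adm s1 t1 u1 u1' v1 v1'" and adm2: "adm s2 t2 u2 u2' v2 v2'"
    and "0 \<le> l" "0 \<le> \<kappa>"
    and gap: "\<And>x. \<bar>x\<bar> \<le> l \<Longrightarrow> pot (u1 x) (v1 x) + pot (u2 x) (v2 x) + \<kappa>
      \<le> pot (sqrt ((u1 x)\<^sup>2 + (u2 x)\<^sup>2)) (sqrt ((v1 x)\<^sup>2 + (v2 x)\<^sup>2))"
  shows "I (s1 + s2) (t1 + t2) \<le> J u1 u1' v1 v1' + J u2 u2' v2 v2' - 2 * l * \<kappa>"
proof -
  note a1 = admD[OF adm1] and a2 = admD[OF adm2]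
  define U V where "U x = sqrt ((u1 x)\<^sup>2 + (u2 x)\<^sup>2)" and "V x = sqrt ((v1 x)\<^sup>2 + (v2 x)\<^sup>2)" for x
  have normU: "norm (u1 x, u2 x) = U x" and normV: "norm (v1 x, v2 x) = V x" for x
    by (simp_all add: norm_Pair U_def V_def)
  obtain U' where U': "sobolev U U'" "AE x in lborel. \<bar>U' x\<bar> \<le> norm (u1' x, u2' x)"
    by (rule sobolev_norm[OF sobolev_Pair[OF a1(1) a2(1)], unfolded normU])
       (rule that)
  obtain V' where V': "sobolev V V'" "AE x in lborel. \<bar>V' x\<bar> \<le> norm (v1' x, v2' x)"
    by (rule sobolev_norm[OF sobolev_Pair[OF a1(2) a2(2)], unfolded normV])
       (rule that)
  have adm: "adm (s1 + s2) (t1 + t2) U U' V V'"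
    unfolding adm_def
  proof (intro conjI allI U'(1) V'(1))
    show "(LBINT x. (U x)\<^sup>2) = s1 + s2" "(LBINT x. (V x)\<^sup>2) = t1 + t2"
      using sobolev_integrable(1)[OF a1(1)] sobolev_integrable(1)[OF a2(1)]
        sobolev_integrable(1)[OF a1(2)] sobolev_integrable(1)[OF a2(2)]
      by (simp_all add: U_def V_def a1(5,6) a2(5,6))
  qed (auto simp: U_def V_def)
  have sq: "a\<^sup>2 \<le> b\<^sup>2 + c\<^sup>2" if "\<bar>a\<bar> \<le> norm (b, c)" for a b c :: real
    using power_mono[OF that, of 2] by (simp add: norm_Pair)
  have ind: "integrable lborel (\<lambda>x. \<kappa> * indicator {- l..l} x)" using \<open>0 \<le> l\<close> by simp
  have "I (s1 + s2) (t1 + t2) \<le> J U U' V V'" by (rule I_le[OF adm])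
  also have "\<dots> \<le> (LBINT x. ((u1' x)\<^sup>2 + (v1' x)\<^sup>2 - pot (u1 x) (v1 x))
      + ((u2' x)\<^sup>2 + (v2' x)\<^sup>2 - pot (u2 x) (v2 x)) - \<kappa> * indicator {- l..l} x)"
    unfolding J_def
  proof (rule integral_mono_AE)
    show "AE x in lborel. (U' x)\<^sup>2 + (V' x)\<^sup>2 - pot (U x) (V x) \<le> ((u1' x)\<^sup>2 + (v1' x)\<^sup>2 - pot (u1 x) (v1 x))
      + ((u2' x)\<^sup>2 + (v2' x)\<^sup>2 - pot (u2 x) (v2 x)) - \<kappa> * indicator {- l..l} x"
      using U'(2) V'(2)
    proof eventually_elim
      case (elim x)
      have "pot (u1 x) (v1 x) + pot (u2 x) (v2 x) + \<kappa> * indicator {- l..l} x \<le> pot (U x) (V x)"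
        using gap[of x] pot_superadditive[OF a1(3) a2(3) a1(4) a2(4), of x]
        by (cases "\<bar>x\<bar> \<le> l") (auto simp: U_def V_def indicator_def abs_le_iff)
      then show ?case using sq[OF elim(1)] sq[OF elim(2)] by linarith
    qed
  qed (use adm_integrable(5)[OF adm1] adm_integrable(5)[OF adm2] adm_integrable(5)[OF adm] ind in auto)
  also have "\<dots> = J u1 u1' v1 v1' + J u2 u2' v2 v2' - 2 * l * \<kappa>"
    using adm_integrable(5)[OF adm1] adm_integrable(5)[OF adm2] ind \<open>0 \<le> l\<close>
    by (simp add: J_def)
  finally show ?thesis .
qed

lemma I_subadditive:
  assumes "0 \<le> s1" "0 \<le> s2" "0 \<le> t1" "0 \<le> t2"
  shows "I (s1 + s2) (t1 + t2) \<le> I s1 t1 + I s2 t2"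
proof (rule field_le_epsilon)
  fix e :: real assume "0 < e"
  obtain u1 u1' v1 v1' where 1: "adm s1 t1 u1 u1' v1 v1'" "J u1 u1' v1 v1' < I s1 t1 + e / 2"
    using I_approx[OF assms(1,3) half_gt_zero[OF \<open>0 < e\<close>]] by blast
  obtain u2 u2' v2 v2' where 2: "adm s2 t2 u2 u2' v2 v2'" "J u2 u2' v2 v2' < I s2 t2 + e / 2"
    using I_approx[OF assms(2,4) half_gt_zero[OF \<open>0 < e\<close>]] by blast
  \<comment> \<open>With \<open>l\<close> and \<open>\<kappa>\<close> zero, plain superadditivity of
    \<open>pot\<close> is all that is asked for.\<close>
  have "I (s1 + s2) (t1 + t2) \<le> J u1 u1' v1 v1' + J u2 u2' v2 v2' - 2 * 0 * 0"
    by (rule I_superposition[OF 1(1) 2(1)])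
       (auto intro!: pot_superadditive admD[OF 1(1)] admD[OF 2(1)])
  then show "I (s1 + s2) (t1 + t2) \<le> I s1 t1 + I s2 t2 + e" using 1(2) 2(2) by linarith
qed

section \<open>Negativity of the infimum and peaks of near-minimisers\<close>

lemma adm_shift:
  assumes "adm s t u u' v v'"
  shows "adm s t (\<lambda>x. u (c + x)) (\<lambda>x. u' (c + x)) (\<lambda>x. v (c + x)) (\<lambda>x. v' (c + x))"
    "J (\<lambda>x. u (c + x)) (\<lambda>x. u' (c + x)) (\<lambda>x. v (c + x)) (\<lambda>x. v' (c + x)) = J u u' v v'"
proof -
  have eq: "(LBINT x. f (c + x)) = (LBINT x. f x)" for f :: "real \<Rightarrow> real"
    using lborel_integral_real_affine[of 1 f c] by simp
  show "adm s t (\<lambda>x. u (c + x)) (\<lambda>x. u' (c + x)) (\<lambda>x. v (c + x)) (\<lambda>x. v' (c + x))"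
    using assms eq[of "\<lambda>x. (u x)\<^sup>2"] eq[of "\<lambda>x. (v x)\<^sup>2"]
    by (auto simp: adm_def intro: sobolev_shift)
  show "J (\<lambda>x. u (c + x)) (\<lambda>x. u' (c + x)) (\<lambda>x. v (c + x)) (\<lambda>x. v' (c + x)) = J u u' v v'"
    unfolding J_def by (rule eq)
qed

text \<open>Spreading the mass over a width \<open>L\<close> costs kinetic energy of order L^-2 and
  gains potential of order L^(1 - r) with \<open>r = (p + 2) / 2\<close>. As \<open>p < 4\<close>
  means \<open>r < 3\<close>, the gain wins for large \<open>L\<close>.\<close>

lemma I_0_neg:
  assumes "0 < t"
  shows "I 0 t < 0"
proof -
  define r where "r = (p + 2) / 2"
  \<comment> \<open>The threshold for L^(3 - r) above which the bounds of
    \<open>sobolev_wide_bump\<close> make the energy negative; \<open>L\<close> is chosen to give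
    \<open>X + 1\<close>.\<close>
  define X where "X = 8 * t / (\<beta>2 * (t / 8) powr r)"
  define L where "L = (X + 1) powr (1 / (3 - r))"
  have r: "0 < 3 - r" using p by (simp add: r_def)
  have X: "0 < X" using assms \<beta>2 by (simp add: X_def)
  have L: "0 < L" "L powr (3 - r) = X + 1" using X r by (auto simp: L_def powr_powr)
  obtain v v' where v: "sobolev v v'" "\<And>x. 0 \<le> v x" "(LBINT x. (v x)\<^sup>2) = t"
    "(LBINT x. (v' x)\<^sup>2) \<le> 8 * t / L\<^sup>2" "\<And>x. \<bar>x\<bar> \<le> L / 2 \<Longrightarrow> t / (8 * L) \<le> (v x)\<^sup>2"
    using sobolev_wide_bump[OF L(1), of t] assms by (metis less_imp_le)
  have adm: "adm 0 t (\<lambda>x. 0) (\<lambda>x. 0) v v'"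
    using v sobolev_zero by (simp add: adm_def)
  have "(LBINT x. (t / (8 * L)) powr r * indicator {- L / 2..L / 2} x) \<le> (LBINT x. v x powr (p + 2))"
  proof (rule integral_mono)
    show "integrable lborel (\<lambda>x. (t / (8 * L)) powr r * indicator {- L / 2..L / 2} x)" using L by simp
    show "integrable lborel (\<lambda>x. v x powr (p + 2))" by (rule adm_integrable(2)[OF adm])
    fix x
    show "(t / (8 * L)) powr r * indicator {- L / 2..L / 2} x \<le> v x powr (p + 2)"
    proof (cases "\<bar>x\<bar> \<le> L / 2")
      case True
      have "(t / (8 * L)) powr r \<le> ((v x)\<^sup>2) powr r"
        using v(5)[OF True] assms L p by (intro powr_mono2) (auto simp: r_def)
      also have "\<dots> = v x powr (p + 2)"
        using v(2)[of x] by (cases "v x = 0") (auto simp: r_def powr_powr add_divide_distrib simp flip: powr_numeral)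
      finally show ?thesis using True by (simp add: indicator_def)
    qed (auto simp: indicator_def abs_le_iff)
  qed
  then have low: "L * (t / (8 * L)) powr r \<le> (LBINT x. v x powr (p + 2))"
    using L by (simp add: mult.commute)
  have "8 * t = \<beta>2 * (t / 8) powr r * X" using assms \<beta>2 by (simp add: X_def)
  also have "\<dots> < \<beta>2 * (t / 8) powr r * L powr (3 - r)" using assms \<beta>2 L by simp
  finally have "8 * t / L\<^sup>2 < \<beta>2 * (t / 8) powr r * L powr (3 - r) / L\<^sup>2" using L by (intro divide_strict_right_mono) auto
  also have "\<dots> = \<beta>2 * (L * (t / (8 * L)) powr r)"
  proof -
    have 1: "L powr (3 - r) = L * L\<^sup>2 / L powr r"
      using L(1) by (simp add: powr_diff power2_eq_square power3_eq_cube)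
    have 2: "(t / (8 * L)) powr r = (t / 8) powr r / L powr r"
      using L assms by (simp add: powr_divide powr_mult)
    show ?thesis unfolding 1 2 using L(1) by (simp add: field_simps power2_eq_square)
  qed
  also have "\<dots> \<le> \<beta>2 * (LBINT x. v x powr (p + 2))" using low \<beta>2 by simp
  finally have "J (\<lambda>x. 0) (\<lambda>x. 0) v v' < 0" using v(4) q by (simp add: J_split[OF adm])
  then show ?thesis using I_le[OF adm] by linarith
qed

text \<open>Without mass, \<open>sobolev_sup_bound\<close> leaves only the term
  \<open>2 * h * D\<close>, and \<open>h > 0\<close> is arbitrary.\<close>

lemma adm_zero_v:
  assumes "adm s 0 u u' v v'"
  shows "v x = 0"
proof -
  note a = admD[OF assms]
  define D where "D = (LBINT x. (v' x)\<^sup>2)"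
  have "0 \<le> D" by (simp add: D_def)
  have bound: "(v x)\<^sup>2 \<le> 2 * h * D" if "h > 0" for h
    using sobolev_sup_bound[OF a(2) that, of x] by (simp add: a(6) D_def)
  have "(v x)\<^sup>2 \<le> 0"
  proof (rule field_le_epsilon)
    fix e :: real assume "0 < e"
    have "(v x)\<^sup>2 \<le> 2 * (e / (2 * (D + 1))) * D"
      using \<open>0 < e\<close> \<open>0 \<le> D\<close> by (intro bound) auto
    also have "\<dots> \<le> e" using \<open>0 < e\<close> \<open>0 \<le> D\<close> by (simp add: field_simps)
    finally show "(v x)\<^sup>2 \<le> 0 + e" by simp
  qed
  then show ?thesis by simp
qed

lemma adm_drop_v:
  assumes "adm s t u u' v v'"
  shows "adm s 0 u u' (\<lambda>x. 0) (\<lambda>x. 0)"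
    "J u u' (\<lambda>x. 0) (\<lambda>x. 0) = (LBINT x. (u' x)\<^sup>2) - \<beta>1 * (LBINT x. u x powr (q + 2))"
proof -
  show *: "adm s 0 u u' (\<lambda>x. 0) (\<lambda>x. 0)"
    using assms sobolev_zero by (auto simp: adm_def)
  show "J u u' (\<lambda>x. 0) (\<lambda>x. 0) = (LBINT x. (u' x)\<^sup>2) - \<beta>1 * (LBINT x. u x powr (q + 2))"
    using p by (simp add: J_split[OF *])
qed

text \<open>Coercivity makes the bound uniform over a sublevel set of \<open>J\<close>. The maximum
  with 1 keeps \<open>C\<close> positive, because peak widths are obtained by dividing by
  it.\<close>

lemma derivative_bound:
  assumes "0 \<le> s" "0 \<le> t"
  obtains C where "0 < C"
    "\<And>u u' v v'. adm s t u u' v v' \<Longrightarrow> J u u' v v' < B \<Longrightarrow> (LBINT x. (u' x)\<^sup>2) \<le> C"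
    "\<And>u u' v v'. adm s t u u' v v' \<Longrightarrow> J u u' v v' < B \<Longrightarrow> (LBINT x. (v' x)\<^sup>2) \<le> C"
proof -
  obtain K where K: "\<And>u u' v v'. adm s t u u' v v' \<Longrightarrow>
    ((LBINT x. (u' x)\<^sup>2) + (LBINT x. (v' x)\<^sup>2)) / 2 - K \<le> J u u' v v'"
    using coercive[OF assms] by blast
  define C where "C = max 1 (2 * (B + K))"
  have *: "(LBINT x. (u' x)\<^sup>2) \<le> C \<and> (LBINT x. (v' x)\<^sup>2) \<le> C"
    if "adm s t u u' v v'" "J u u' v v' < B" for u u' v v'
  proof -
    define D1 D2 where "D1 = (LBINT x. (u' x)\<^sup>2)" and "D2 = (LBINT x. (v' x)\<^sup>2)"
    have D: "0 \<le> D1" "0 \<le> D2" by (auto simp: D1_def D2_def)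
    have "(D1 + D2) / 2 - K < B" using K[OF that(1)] that(2) by (simp add: D1_def D2_def)
    then have "D1 + D2 < 2 * (B + K)" by (simp add: field_simps)
    then have "D1 \<le> C" "D2 \<le> C" unfolding C_def le_max_iff_disj using D by auto
    then show ?thesis by (simp add: D1_def D2_def)
  qed
  show thesis
    by (rule that[of C]) (use * in \<open>auto simp: C_def\<close>)
qed

text \<open>Near-minimisers cannot have a uniformly small second component, since \<open>I s t\<close> lies strictly
  below \<open>I s 0\<close>; a bound on the derivative then keeps that component large near its peak, which is
  translated to the origin.\<close>

lemma peak_v:
  assumes "0 \<le> s" "0 < t"
  obtains m l e where "0 < m" "0 < l" "0 < e" "\<And>\<epsilon>. 0 < \<epsilon> \<Longrightarrow> \<epsilon> \<le> e \<Longrightarrow>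
    \<exists>u u' v v'. adm s t u u' v v' \<and> J u u' v v' < I s t + \<epsilon> \<and> (\<forall>x. \<bar>x\<bar> \<le> l \<longrightarrow> m \<le> v x)"
proof -
  \<comment> \<open>Half of the room that subadditivity leaves between \<open>I s t\<close> and
    \<open>I s 0\<close>: one half is for the tolerance, the other for the terms lost when
    \<open>v\<close> is dropped.\<close>
  define e where "e = - I 0 t / 2"
  have "0 < e" using I_0_neg[OF assms(2)] by (simp add: e_def)
  \<comment> \<open>If \<open>v \<le> m \<le> 1\<close> everywhere, the two potential terms
    containing \<open>v\<close> are at most \<open>m * c\<close>, because \<open>p \<ge> 1\<close>
    gives \<open>m powr p \<le> m\<close>.\<close>
  define c where "c = \<beta>2 * t + \<alpha> * s"
  have "0 < c" using assms \<alpha> \<beta>2 by (simp add: c_def add_pos_nonneg)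
  define m where "m = min 1 (e / c)"
  have m: "0 < m" "m \<le> 1" "m * c \<le> e"
    using \<open>0 < e\<close> \<open>0 < c\<close> by (auto simp: m_def min_def field_simps)
  have "I s t \<le> I s 0 + I 0 t" using I_subadditive[of s 0 0 t] assms by simp
  then have I_le0: "I s t + e \<le> I s 0 - e" by (simp add: e_def)
  obtain C where "0 < C"
    and C: "\<And>u u' v v'. adm s t u u' v v' \<Longrightarrow> J u u' v v' < I s t + e \<Longrightarrow> (LBINT x. (v' x)\<^sup>2) \<le> C"
    by (rule derivative_bound[OF assms(1) less_imp_le[OF assms(2)], of "I s t + e"]) (rule that)
  define l where "l = (m / 2)\<^sup>2 / C"
  show thesis
  proof (rule that[of "m / 2" l e])
    fix \<epsilon> assume \<epsilon>: "0 < \<epsilon>" "\<epsilon> \<le> e"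
    obtain u u' v v' where adm: "adm s t u u' v v'" and J: "J u u' v v' < I s t + \<epsilon>"
      using I_approx[OF assms(1) less_imp_le[OF assms(2)] \<epsilon>(1)] .
    note a = admD[OF adm]
    have "\<exists>x0. m < v x0"
    proof (rule ccontr)
      assume "\<nexists>x0. m < v x0"
      then have v: "v x \<le> m" "\<bar>v x\<bar> \<le> m" for x using a(4)[of x] by (auto simp: not_less)
      have "(LBINT x. v x powr (p + 2)) \<le> m powr p * t"
        using sobolev_powr_integral(2)[OF a(2,4) v(1), of "p + 2"] p by (simp add: a)
      also have "\<dots> \<le> m powr 1 * t" using m p assms by (intro mult_right_mono powr_mono') auto
      finally have 1: "\<beta>2 * (LBINT x. v x powr (p + 2)) \<le> \<beta>2 * (m * t)"
        using m \<beta>2 by (intro mult_left_mono) auto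
      have 2: "\<alpha> * (LBINT x. (u x)\<^sup>2 * v x) \<le> \<alpha> * (m * s)"
        using sobolev_product_integral(2)[OF a(1) sobolev_measurable(1)[OF a(2)] v(2)] \<alpha>
        by (intro mult_left_mono) (auto simp: a)
      define D1 D2 where "D1 = (LBINT x. (u' x)\<^sup>2)" and "D2 = (LBINT x. (v' x)\<^sup>2)"
      have "0 \<le> D2" by (simp add: D2_def)
      have "I s 0 \<le> D1 - \<beta>1 * (LBINT x. u x powr (q + 2))"
        using I_le[OF adm_drop_v(1)[OF adm]] by (simp add: adm_drop_v(2)[OF adm] D1_def)
      moreover have "J u u' v v' = D1 + D2 - \<beta>1 * (LBINT x. u x powr (q + 2))
          - \<beta>2 * (LBINT x. v x powr (p + 2)) - \<alpha> * (LBINT x. (u x)\<^sup>2 * v x)"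
        by (simp add: J_split[OF adm] D1_def D2_def)
      moreover have "\<beta>2 * (m * t) + \<alpha> * (m * s) \<le> e" using m(3) by (simp add: c_def algebra_simps)
      ultimately have "I s 0 - e \<le> J u u' v v'" using 1 2 \<open>0 \<le> D2\<close> by simp
      then show False using J \<epsilon> I_le0 by linarith
    qed
    then obtain x0 where x0: "m < v x0" by blast
    note adm' = adm_shift[OF adm, of x0]
    have "m / 2 \<le> v (x0 + x)" if "\<bar>x\<bar> \<le> l" for x
    proof (rule sobolev_peak_persists[OF admD(2)[OF adm'(1)] _ _ that])
      show "(LBINT t. (v' (x0 + t))\<^sup>2) \<le> C"
        using C[OF adm'(1)] adm'(2) J \<epsilon> by simp
      show "l * C \<le> (m / 2)\<^sup>2" using \<open>0 < C\<close> by (simp add: l_def)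
    qed (use x0 m in auto)
    then show "\<exists>u u' v v'. adm s t u u' v v' \<and> J u u' v v' < I s t + \<epsilon> \<and> (\<forall>x. \<bar>x\<bar> \<le> l \<longrightarrow> m / 2 \<le> v x)"
      using adm' J by metis
  qed (use m \<open>0 < C\<close> \<open>0 < e\<close> in \<open>auto simp: l_def\<close>)
qed

text \<open>With \<open>v = 0\<close> only the \<open>\<beta>1\<close> term can make the energy
  negative, and a uniformly small \<open>u\<close> would make it larger than half of
  \<open>I s 0\<close>. The \<open>+ 1\<close> in \<open>c\<close> permits division by it when
  \<open>\<beta>1 * s\<close> is zero.\<close>

lemma peak_u:
  assumes "0 \<le> s" "I s 0 < 0"
  obtains m l e where "0 < m" "0 < l" "0 < e" "\<And>\<epsilon>. 0 < \<epsilon> \<Longrightarrow> \<epsilon> \<le> e \<Longrightarrow>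
    \<exists>u u' v v'. adm s 0 u u' v v' \<and> J u u' v v' < I s 0 + \<epsilon> \<and> (\<forall>x. \<bar>x\<bar> \<le> l \<longrightarrow> m \<le> u x)"
proof -
  define e where "e = - I s 0 / 2"
  have "0 < e" using assms(2) by (simp add: e_def)
  define c where "c = \<beta>1 * s + 1"
  have "0 < c" using assms \<beta>1 by (simp add: c_def add_nonneg_pos)
  define m where "m = min 1 (e / c)"
  have m: "0 < m" "m \<le> 1" "m * c \<le> e"
    using \<open>0 < e\<close> \<open>0 < c\<close> by (auto simp: m_def min_def field_simps)
  obtain C where "0 < C"
    and C: "\<And>u u' v v'. adm s 0 u u' v v' \<Longrightarrow> J u u' v v' < I s 0 + e \<Longrightarrow> (LBINT x. (u' x)\<^sup>2) \<le> C"
    by (rule derivative_bound[OF assms(1) order_refl, of "I s 0 + e"]) (rule that)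
  define l where "l = (m / 2)\<^sup>2 / C"
  show thesis
  proof (rule that[of "m / 2" l e])
    fix \<epsilon> assume \<epsilon>: "0 < \<epsilon>" "\<epsilon> \<le> e"
    obtain u u' v v' where adm: "adm s 0 u u' v v'" and J: "J u u' v v' < I s 0 + \<epsilon>"
      using I_approx[OF assms(1) order_refl \<epsilon>(1)] .
    note a = admD[OF adm]
    have "\<exists>x0. m < u x0"
    proof (rule ccontr)
      assume "\<nexists>x0. m < u x0"
      then have u: "u x \<le> m" for x by (auto simp: not_less)
      have "(LBINT x. u x powr (q + 2)) \<le> m powr q * s"
        using sobolev_powr_integral(2)[OF a(1,3) u, of "q + 2"] q by (simp add: a)
      also have "\<dots> \<le> m powr 1 * s" using m q assms by (intro mult_right_mono powr_mono') auto
      finally have 1: "\<beta>1 * (LBINT x. u x powr (q + 2)) \<le> \<beta>1 * (m * s)"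
        using m \<beta>1 by (intro mult_left_mono) auto
      define D1 D2 where "D1 = (LBINT x. (u' x)\<^sup>2)" and "D2 = (LBINT x. (v' x)\<^sup>2)"
      have D: "0 \<le> D1" "0 \<le> D2" by (simp_all add: D1_def D2_def)
      have "J u u' v v' = D1 + D2 - \<beta>1 * (LBINT x. u x powr (q + 2))"
        using p by (simp add: J_split[OF adm] D1_def D2_def adm_zero_v[OF adm])
      moreover have "\<beta>1 * (m * s) \<le> e" using m by (simp add: c_def algebra_simps)
      ultimately have "- e \<le> J u u' v v'" using 1 D by simp
      then show False using J \<epsilon> by (simp add: e_def)
    qed
    then obtain x0 where x0: "m < u x0" by blast
    note adm' = adm_shift[OF adm, of x0]
    have "m / 2 \<le> u (x0 + x)" if "\<bar>x\<bar> \<le> l" for x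
    proof (rule sobolev_peak_persists[OF admD(1)[OF adm'(1)] _ _ that])
      show "(LBINT t. (u' (x0 + t))\<^sup>2) \<le> C"
        using C[OF adm'(1)] adm'(2) J \<epsilon> by simp
      show "l * C \<le> (m / 2)\<^sup>2" using \<open>0 < C\<close> by (simp add: l_def)
    qed (use x0 m in auto)
    then show "\<exists>u u' v v'. adm s 0 u u' v v' \<and> J u u' v v' < I s 0 + \<epsilon> \<and> (\<forall>x. \<bar>x\<bar> \<le> l \<longrightarrow> m / 2 \<le> u x)"
      using adm' J by metis
  qed (use m \<open>0 < C\<close> \<open>0 < e\<close> in \<open>auto simp: l_def\<close>)
qed

section \<open>Strict subadditivity\<close>

lemma I_strict_both_v:
  assumes "0 \<le> s1" "0 \<le> s2" "0 < t1" "0 < t2"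
  shows "I (s1 + s2) (t1 + t2) < I s1 t1 + I s2 t2"
proof -
  obtain m1 l1 e1 where 1: "0 < m1" "0 < l1" "0 < e1" "\<And>\<epsilon>. 0 < \<epsilon> \<Longrightarrow> \<epsilon> \<le> e1 \<Longrightarrow>
    \<exists>u u' v v'. adm s1 t1 u u' v v' \<and> J u u' v v' < I s1 t1 + \<epsilon> \<and> (\<forall>x. \<bar>x\<bar> \<le> l1 \<longrightarrow> m1 \<le> v x)"
    using peak_v[OF assms(1,3)] by metis
  obtain m2 l2 e2 where 2: "0 < m2" "0 < l2" "0 < e2" "\<And>\<epsilon>. 0 < \<epsilon> \<Longrightarrow> \<epsilon> \<le> e2 \<Longrightarrow>
    \<exists>u u' v v'. adm s2 t2 u u' v v' \<and> J u u' v v' < I s2 t2 + \<epsilon> \<and> (\<forall>x. \<bar>x\<bar> \<le> l2 \<longrightarrow> m2 \<le> v x)"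
    using peak_v[OF assms(2,4)] by metis
  define m l where "m = min m1 m2" and "l = min l1 l2"
  have ml: "0 < m" "0 < l" using 1 2 by (auto simp: m_def l_def)
  define \<kappa> where "\<kappa> = \<beta>2 * ((sqrt 2 powr p - 1) * m powr (p + 2))"
  have "1 < sqrt 2 powr p" using p by (intro gr_one_powr) auto
  then have \<kappa>: "0 < \<kappa>" using \<beta>2 ml by (simp add: \<kappa>_def)
  \<comment> \<open>The gain \<open>2 * l * \<kappa>\<close> is already fixed and has to beat two
    errors, each strictly below \<open>\<epsilon>\<close>.\<close>
  define \<epsilon> where "\<epsilon> = min (min e1 e2) (l * \<kappa>)"
  have \<epsilon>: "0 < \<epsilon>" "\<epsilon> \<le> e1" "\<epsilon> \<le> e2" "\<epsilon> \<le> l * \<kappa>" using 1 2 ml \<kappa> by (auto simp: \<epsilon>_def)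
  obtain u1 u1' v1 v1' where a1: "adm s1 t1 u1 u1' v1 v1'" "J u1 u1' v1 v1' < I s1 t1 + \<epsilon>"
    and v1: "\<And>x. \<bar>x\<bar> \<le> l1 \<Longrightarrow> m1 \<le> v1 x" using 1(4)[OF \<epsilon>(1,2)] by blast
  obtain u2 u2' v2 v2' where a2: "adm s2 t2 u2 u2' v2 v2'" "J u2 u2' v2 v2' < I s2 t2 + \<epsilon>"
    and v2: "\<And>x. \<bar>x\<bar> \<le> l2 \<Longrightarrow> m2 \<le> v2 x" using 2(4)[OF \<epsilon>(1,3)] by blast
  have "I (s1 + s2) (t1 + t2) \<le> J u1 u1' v1 v1' + J u2 u2' v2 v2' - 2 * l * \<kappa>"
  proof (rule I_superposition[OF a1(1) a2(1)])
    fix x assume "\<bar>x\<bar> \<le> l"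
    then have "m \<le> v1 x" "m \<le> v2 x" using v1[of x] v2[of x] by (auto simp: l_def m_def)
    then show "pot (u1 x) (v1 x) + pot (u2 x) (v2 x) + \<kappa>
      \<le> pot (sqrt ((u1 x)\<^sup>2 + (u2 x)\<^sup>2)) (sqrt ((v1 x)\<^sup>2 + (v2 x)\<^sup>2))"
      unfolding \<kappa>_def using ml admD[OF a1(1)] admD[OF a2(1)] by (intro pot_gap_v) auto
  qed (use ml \<kappa> in auto)
  then show ?thesis using a1(2) a2(2) \<epsilon>(4) by (simp add: mult.assoc)
qed

text \<open>If \<open>I s2 0 \<ge> 0\<close>, minimising sequences for \<open>I s2 0\<close> may spread out and vanish; then a wide tent of
  mass \<open>s2\<close> and width \<open>L\<close> is superposed instead: it costs \<open>O(1 / L\<^sup>2)\<close> and gains a multiple of \<open>1 / L\<close>.\<close>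

lemma I_strict_one_v:
  assumes "0 \<le> s1" "0 < s2" "0 < t1"
  shows "I (s1 + s2) t1 < I s1 t1 + I s2 0"
proof -
  obtain m1 l1 e1 where 1: "0 < m1" "0 < l1" "0 < e1" "\<And>\<epsilon>. 0 < \<epsilon> \<Longrightarrow> \<epsilon> \<le> e1 \<Longrightarrow>
    \<exists>u u' v v'. adm s1 t1 u u' v v' \<and> J u u' v v' < I s1 t1 + \<epsilon> \<and> (\<forall>x. \<bar>x\<bar> \<le> l1 \<longrightarrow> m1 \<le> v x)"
    using peak_v[OF assms(1,3)] by metis
  show ?thesis
  proof (cases "I s2 0 < 0")
    case True
    obtain m2 l2 e2 where 2: "0 < m2" "0 < l2" "0 < e2" "\<And>\<epsilon>. 0 < \<epsilon> \<Longrightarrow> \<epsilon> \<le> e2 \<Longrightarrow>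
      \<exists>u u' v v'. adm s2 0 u u' v v' \<and> J u u' v v' < I s2 0 + \<epsilon> \<and> (\<forall>x. \<bar>x\<bar> \<le> l2 \<longrightarrow> m2 \<le> u x)"
      using peak_u[OF less_imp_le[OF assms(2)] True] by metis
    define l where "l = min l1 l2"
    have l: "0 < l" using 1 2 by (auto simp: l_def)
    \<comment> \<open>A lower bound for the new coupling term of \<open>pot_gap_u\<close> where the
      peak of \<open>u2\<close> meets the peak of \<open>v1\<close>.\<close>
    define \<kappa> where "\<kappa> = \<alpha> * (m2\<^sup>2 * m1)"
    have \<kappa>: "0 < \<kappa>" using \<alpha> 1 2 by (simp add: \<kappa>_def)
    define \<epsilon> where "\<epsilon> = min (min e1 e2) (l * \<kappa>)"
    have \<epsilon>: "0 < \<epsilon>" "\<epsilon> \<le> e1" "\<epsilon> \<le> e2" "\<epsilon> \<le> l * \<kappa>" using 1 2 l \<kappa> by (auto simp: \<epsilon>_def)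
    obtain u1 u1' v1 v1' where a1: "adm s1 t1 u1 u1' v1 v1'" "J u1 u1' v1 v1' < I s1 t1 + \<epsilon>"
      and v1: "\<And>x. \<bar>x\<bar> \<le> l1 \<Longrightarrow> m1 \<le> v1 x" using 1(4)[OF \<epsilon>(1,2)] by blast
    obtain u2 u2' v2 v2' where a2: "adm s2 0 u2 u2' v2 v2'" "J u2 u2' v2 v2' < I s2 0 + \<epsilon>"
      and u2: "\<And>x. \<bar>x\<bar> \<le> l2 \<Longrightarrow> m2 \<le> u2 x" using 2(4)[OF \<epsilon>(1,3)] by blast
    have "I (s1 + s2) (t1 + 0) \<le> J u1 u1' v1 v1' + J u2 u2' v2 v2' - 2 * l * \<kappa>"
    proof (rule I_superposition[OF a1(1) a2(1)])
      fix x assume "\<bar>x\<bar> \<le> l"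
      then have "m1 \<le> v1 x" "m2 \<le> u2 x" using v1[of x] u2[of x] by (auto simp: l_def)
      then have "\<kappa> \<le> \<alpha> * ((u2 x)\<^sup>2 * v1 x)"
        unfolding \<kappa>_def using 1(1) 2(1) \<alpha> by (intro mult_left_mono mult_mono power_mono) auto
      then show "pot (u1 x) (v1 x) + pot (u2 x) (v2 x) + \<kappa>
        \<le> pot (sqrt ((u1 x)\<^sup>2 + (u2 x)\<^sup>2)) (sqrt ((v1 x)\<^sup>2 + (v2 x)\<^sup>2))"
        using pot_gap_u[of "u1 x" "u2 x" "v1 x"] admD(3)[OF a1(1), of x] admD(3)[OF a2(1), of x]
          admD(4)[OF a1(1), of x] unfolding adm_zero_v[OF a2(1)] by linarith
    qed (use l \<kappa> in auto)
    then show ?thesis using a1(2) a2(2) \<epsilon>(4) by (simp add: mult.assoc)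
  next
    case False
    define c where "c = l1 * \<alpha> * m1"
    have c: "0 < c" using 1 \<alpha> by (simp add: c_def)
    \<comment> \<open>The first bound puts \<open>{- l1..l1}\<close> inside the zone where the tent
      is high. The second balances the cost \<open>8 * s2 / L\<^sup>2\<close> against
      \<open>l1 * \<kappa> = c * s2 / (8 * L)\<close>, which needs
      \<open>64 \<le> c * L\<close>.\<close>
    define L where "L = max (2 * l1) (64 / c)"
    have L: "0 < L" "l1 \<le> L / 2" "64 / c \<le> L" using 1 by (auto simp: L_def)
    then have cL: "64 \<le> c * L" using c by (simp add: field_simps)
    obtain u2 u2' where u2: "sobolev u2 u2'" "\<And>x. 0 \<le> u2 x" "(LBINT x. (u2 x)\<^sup>2) = s2"
      "(LBINT x. (u2' x)\<^sup>2) \<le> 8 * s2 / L\<^sup>2" "\<And>x. \<bar>x\<bar> \<le> L / 2 \<Longrightarrow> s2 / (8 * L) \<le> (u2 x)\<^sup>2"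
      using sobolev_wide_bump[OF L(1) less_imp_le[OF assms(2)]] by metis
    have a2: "adm s2 0 u2 u2' (\<lambda>x. 0) (\<lambda>x. 0)"
      using u2 sobolev_zero by (simp add: adm_def)
    have J2: "J u2 u2' (\<lambda>x. 0) (\<lambda>x. 0) \<le> 8 * s2 / L\<^sup>2"
    proof -
      have "0 \<le> \<beta>1 * (LBINT x. u2 x powr (q + 2))" using \<beta>1 by simp
      then show ?thesis using u2(4) by (simp add: adm_drop_v(2)[OF a2])
    qed
    define \<kappa> where "\<kappa> = \<alpha> * (s2 / (8 * L) * m1)"
    have \<kappa>: "0 < \<kappa>" using \<alpha> 1 assms L by (simp add: \<kappa>_def)
    define \<epsilon> where "\<epsilon> = min e1 (l1 * \<kappa>)"
    have \<epsilon>: "0 < \<epsilon>" "\<epsilon> \<le> e1" "\<epsilon> \<le> l1 * \<kappa>" using 1 \<kappa> by (auto simp: \<epsilon>_def)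
    obtain u1 u1' v1 v1' where a1: "adm s1 t1 u1 u1' v1 v1'" "J u1 u1' v1 v1' < I s1 t1 + \<epsilon>"
      and v1: "\<And>x. \<bar>x\<bar> \<le> l1 \<Longrightarrow> m1 \<le> v1 x" using 1(4)[OF \<epsilon>(1,2)] by blast
    have "I (s1 + s2) (t1 + 0) \<le> J u1 u1' v1 v1' + J u2 u2' (\<lambda>x. 0) (\<lambda>x. 0) - 2 * l1 * \<kappa>"
    proof (rule I_superposition[OF a1(1) a2])
      fix x assume "\<bar>x\<bar> \<le> l1"
      then have "m1 \<le> v1 x" "s2 / (8 * L) \<le> (u2 x)\<^sup>2" using v1[of x] u2(5)[of x] L by auto
      then have "\<kappa> \<le> \<alpha> * ((u2 x)\<^sup>2 * v1 x)"
        unfolding \<kappa>_def using 1(1) \<alpha> by (intro mult_left_mono mult_mono) auto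
      then show "pot (u1 x) (v1 x) + pot (u2 x) 0 + \<kappa>
        \<le> pot (sqrt ((u1 x)\<^sup>2 + (u2 x)\<^sup>2)) (sqrt ((v1 x)\<^sup>2 + 0\<^sup>2))"
        using pot_gap_u[of "u1 x" "u2 x" "v1 x"] admD(3)[OF a1(1), of x] u2(2)[of x]
          admD(4)[OF a1(1), of x] by linarith
    qed (use 1 \<kappa> in auto)
    moreover have "8 * s2 / L\<^sup>2 \<le> l1 * \<kappa>"
    proof -
      have "64 * s2 \<le> c * L * s2" using cL assms by (intro mult_right_mono) auto
      then show ?thesis using L by (simp add: \<kappa>_def c_def field_simps power2_eq_square)
    qed
    \<comment> \<open>Half of the gain pays for \<open>\<epsilon>\<close>, the other half for the
      tent; the result is below \<open>I s1 t1\<close>, and \<open>I s2 0\<close> is nonnegative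
      here.\<close>
    ultimately show ?thesis using a1(2) J2 \<epsilon>(3) False by (simp add: mult.assoc)
  qed
qed

theorem I_strictly_subadditive:
  assumes "0 \<le> s1" "0 \<le> s2" "0 \<le> t1" "0 \<le> t2"
    and "t1 + t2 > 0" "s1 + t1 > 0" "s2 + t2 > 0"
  shows "I (s1 + s2) (t1 + t2) < I s1 t1 + I s2 t2"
proof -
  \<comment> \<open>Neither pair is massless, so a pair without \<open>v\<close> mass has
    \<open>u\<close> mass; at most one pair lacks \<open>v\<close> mass.\<close>
  consider "0 < t1" "0 < t2" | "t2 = 0" "0 < t1" "0 < s2" | "t1 = 0" "0 < t2" "0 < s1"
    using assms by (cases "t1 = 0"; cases "t2 = 0") auto
  then show ?thesis
  proof cases
    case 1
    then show ?thesis using I_strict_both_v assms by simp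
  next
    case 2
    then show ?thesis using I_strict_one_v[of s1 s2 t1] assms by simp
  next
    case 3
    then show ?thesis using I_strict_one_v[of s2 s1 t2] assms by (simp add: add.commute)
  qed
qed

section \<open>Return to complex-valued functions and the extended real infimum\<close>

context
  fixes \<tau>1 \<tau>2 :: real and P :: rat
  assumes \<tau>: "\<beta>1 = 2 * \<tau>1 / (q + 2)" "\<beta>2 = 2 * \<tau>2 / ((p + 1) * (p + 2))" and P: "p = of_rat P"
begin

lemma P2_pos: "0 < P + 2"
proof -
  have "1 \<le> P" using p(1) by (simp add: P)
  then show ?thesis by simp
qed

lemma of_rat_P2: "of_rat (P + 2) = p + 2"
  by (simp add: P of_rat_add)

lemma energy_eq: "energy \<alpha> \<tau>1 \<tau>2 q P f g =
    (LBINT x. (cmod (weak_deriv f x))\<^sup>2 + (weak_deriv g x)\<^sup>2 - \<beta>1 * cmod (f x) powr (q + 2)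
      - \<beta>2 * odd_power (g x) (P + 2) - \<alpha> * (cmod (f x))\<^sup>2 * g x)"
  by (simp add: energy_def \<tau> P)

lemma energy_of_adm:
  assumes "adm s t u u' v v'"
  shows "(\<lambda>x. complex_of_real (u x), v) \<in> Y"
    "energy \<alpha> \<tau>1 \<tau>2 q P (\<lambda>x. complex_of_real (u x)) v = J u u' v v'"
proof -
  note a = admD[OF assms]
  note cu = sobolev_of_real[OF a(1)]
  show "(\<lambda>x. complex_of_real (u x), v) \<in> Y"
    using sobolev_H1(1)[OF cu] sobolev_H1(1)[OF a(2)] by (simp add: Y_def)
  note [measurable] = sobolev_measurable[OF a(1)] sobolev_measurable[OF a(2)]
    H1_measurable[OF sobolev_H1(1)[OF cu]] H1_measurable[OF sobolev_H1(1)[OF a(2)]]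
    odd_power_powr(3)[OF P2_pos]
  show "energy \<alpha> \<tau>1 \<tau>2 q P (\<lambda>x. complex_of_real (u x)) v = J u u' v v'"
    unfolding energy_eq J_def
  proof (rule integral_cong_AE)
    show "AE x in lborel. (cmod (weak_deriv (\<lambda>x. complex_of_real (u x)) x))\<^sup>2 + (weak_deriv v x)\<^sup>2
        - \<beta>1 * cmod (complex_of_real (u x)) powr (q + 2) - \<beta>2 * odd_power (v x) (P + 2)
        - \<alpha> * (cmod (complex_of_real (u x)))\<^sup>2 * v x = (u' x)\<^sup>2 + (v' x)\<^sup>2 - pot (u x) (v x)"
      using sobolev_H1(2)[OF cu] sobolev_H1(2)[OF a(2)]
    proof eventually_elim
      case (elim x)
      then show ?case using a(3)[of x] a(4)[of x]
        by (simp add: pot_def odd_power_powr(2)[OF P2_pos] of_rat_P2)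
    qed
  qed (unfold pot_def, measurable)
qed

text \<open>Take the moduli of the continuous representatives: the masses stay, the derivatives do
  not grow, and removing the sign of \<open>v\<close> can only enlarge the odd power and the
  coupling, which enter the energy negatively.\<close>

lemma adm_of_Y:
  assumes "(f, g) \<in> Y"
  obtains u u' v v' where "adm (LBINT x. (cmod (f x))\<^sup>2) (LBINT x. (g x)\<^sup>2) u u' v v'"
    "J u u' v v' \<le> energy \<alpha> \<tau>1 \<tau>2 q P f g"
proof -
  have fg: "f \<in> H1" "g \<in> H1" using assms by (auto simp: Y_def)
  obtain F F' where F: "sobolev F F'" "AE x in lborel. f x = F x" "AE x in lborel. weak_deriv f x = F' x"
    using H1_sobolev[OF fg(1)] .
  obtain G G' where G: "sobolev G G'" "AE x in lborel. g x = G x" "AE x in lborel. weak_deriv g x = G' x"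
    using H1_sobolev[OF fg(2)] .
  obtain u' where u': "sobolev (\<lambda>x. norm (F x)) u'" "AE x in lborel. \<bar>u' x\<bar> \<le> norm (F' x)"
    using sobolev_norm[OF F(1)] .
  obtain v' where v': "sobolev (\<lambda>x. norm (G x)) v'" "AE x in lborel. \<bar>v' x\<bar> \<le> norm (G' x)"
    using sobolev_norm[OF G(1)] .
  note [measurable] = sobolev_measurable[OF F(1)] sobolev_measurable[OF G(1)]
    H1_measurable[OF fg(1)] H1_measurable[OF fg(2)] odd_power_powr(3)[OF P2_pos]
  have mass: "(LBINT x. (cmod (f x))\<^sup>2) = (LBINT x. (norm (F x))\<^sup>2)"
    "(LBINT x. (g x)\<^sup>2) = (LBINT x. (norm (G x))\<^sup>2)"
  proof -
    show "(LBINT x. (cmod (f x))\<^sup>2) = (LBINT x. (norm (F x))\<^sup>2)"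
      by (rule integral_cong_AE) (use F(2) in auto)
    show "(LBINT x. (g x)\<^sup>2) = (LBINT x. (norm (G x))\<^sup>2)"
      by (rule integral_cong_AE) (use G(2) in auto)
  qed
  have adm: "adm (LBINT x. (cmod (f x))\<^sup>2) (LBINT x. (g x)\<^sup>2) (\<lambda>x. norm (F x)) u' (\<lambda>x. norm (G x)) v'"
    using u'(1) v'(1) unfolding adm_def mass by auto
  define R where "R x = (norm (F' x))\<^sup>2 + (G' x)\<^sup>2 - \<beta>1 * norm (F x) powr (q + 2)
    - \<beta>2 * odd_power (G x) (P + 2) - \<alpha> * (norm (F x))\<^sup>2 * G x" for x
  have "energy \<alpha> \<tau>1 \<tau>2 q P f g = (LBINT x. R x)"
    unfolding energy_eq
  proof (rule integral_cong_AE)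
    show "AE x in lborel. (cmod (weak_deriv f x))\<^sup>2 + (weak_deriv g x)\<^sup>2 - \<beta>1 * cmod (f x) powr (q + 2)
      - \<beta>2 * odd_power (g x) (P + 2) - \<alpha> * (cmod (f x))\<^sup>2 * g x = R x"
      using F(2,3) G(2,3) by eventually_elim (simp add: R_def)
  qed (unfold R_def, measurable)
  moreover have "J (\<lambda>x. norm (F x)) u' (\<lambda>x. norm (G x)) v' \<le> (LBINT x. R x)"
    unfolding J_def
  proof (rule integral_mono_AE)
    show "integrable lborel (\<lambda>x. (u' x)\<^sup>2 + (v' x)\<^sup>2 - pot (norm (F x)) (norm (G x)))"
      by (rule adm_integrable(5)[OF adm])
    \<comment> \<open>A non-integrable integrand would have integral 0 by default, so the comparison
      rests on the integrability of \<open>R\<close>; its sign-changing terms are dominated by those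
      of the moduli.\<close>
    have "integrable lborel (\<lambda>x. (norm (F' x))\<^sup>2)" "integrable lborel (\<lambda>x. (norm (G' x))\<^sup>2)"
      using F(1) G(1) by (auto simp: sobolev_def L2_def)
    moreover have "integrable lborel (\<lambda>x. odd_power (G x) (P + 2))"
      by (rule Bochner_Integration.integrable_bound[OF adm_integrable(2)[OF adm]])
         (auto simp: odd_power_powr(1)[OF P2_pos] of_rat_P2)
    moreover have "integrable lborel (\<lambda>x. (norm (F x))\<^sup>2 * G x)"
      by (rule Bochner_Integration.integrable_bound[OF adm_integrable(3)[OF adm]]) (auto simp: abs_mult)
    ultimately show "integrable lborel R"
      unfolding R_def using adm_integrable(1)[OF adm] by (simp add: mult.assoc)
    show "AE x in lborel. (u' x)\<^sup>2 + (v' x)\<^sup>2 - pot (norm (F x)) (norm (G x)) \<le> R x"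
      using u'(2) v'(2)
    proof eventually_elim
      case (elim x)
      have "(u' x)\<^sup>2 \<le> (norm (F' x))\<^sup>2" "(v' x)\<^sup>2 \<le> (G' x)\<^sup>2"
        using power_mono[OF elim(1), of 2] power_mono[OF elim(2), of 2] by auto
      moreover have "\<beta>2 * odd_power (G x) (P + 2) \<le> \<beta>2 * norm (G x) powr (p + 2)"
        using abs_ge_self[of "odd_power (G x) (P + 2)"] \<beta>2
        by (intro mult_left_mono) (auto simp: odd_power_powr(1)[OF P2_pos] of_rat_P2)
      moreover have "\<alpha> * (norm (F x))\<^sup>2 * G x \<le> \<alpha> * (norm (F x))\<^sup>2 * norm (G x)"
        using \<alpha> by (intro mult_left_mono) auto
      ultimately show ?case by (simp add: R_def pot_def mult.assoc)
    qed
  qed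
  ultimately show thesis using that adm by simp
qed

text \<open>Moduli of pairs in \<open>Y\<close> are admissible with no larger energy, and admissible
  pairs lie in \<open>Y\<close> with equal energy. In particular the extended real infimum is
  finite.\<close>

lemma min_energy_eq_I:
  assumes "0 \<le> s" "0 \<le> t"
  shows "min_energy \<alpha> \<tau>1 \<tau>2 q P s t = ereal (I s t)"
proof (rule antisym)
  show "ereal (I s t) \<le> min_energy \<alpha> \<tau>1 \<tau>2 q P s t"
    unfolding min_energy_def
  proof (rule Inf_greatest, clarsimp)
    fix f g assume *: "(f, g) \<in> Y"
    obtain u u' v v' where "adm (LBINT x. (cmod (f x))\<^sup>2) (LBINT x. (g x)\<^sup>2) u u' v v'"
      "J u u' v v' \<le> energy \<alpha> \<tau>1 \<tau>2 q P f g" using adm_of_Y[OF *] .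
    then show "I (LBINT x. (cmod (f x))\<^sup>2) (LBINT x. (g x)\<^sup>2) \<le> energy \<alpha> \<tau>1 \<tau>2 q P f g"
      using I_le order_trans by blast
  qed
  show "min_energy \<alpha> \<tau>1 \<tau>2 q P s t \<le> ereal (I s t)"
  proof (rule ereal_le_epsilon2)
    fix e :: real assume "0 < e"
    obtain u u' v v' where adm: "adm s t u u' v v'" and J: "J u u' v v' < I s t + e"
      using I_approx[OF assms \<open>0 < e\<close>] .
    note a = energy_of_adm[OF adm]
    have "(LBINT x. (cmod (complex_of_real (u x)))\<^sup>2) = s" "(LBINT x. (v x)\<^sup>2) = t"
      using admD(5,6)[OF adm] by simp_all
    then have "min_energy \<alpha> \<tau>1 \<tau>2 q P s t \<le> ereal (energy \<alpha> \<tau>1 \<tau>2 q P (\<lambda>x. complex_of_real (u x)) v)"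
      unfolding min_energy_def using a(1) by (intro Inf_lower) blast
    also have "\<dots> \<le> ereal (I s t) + ereal e" using J a(2) by simp
    finally show "min_energy \<alpha> \<tau>1 \<tau>2 q P s t \<le> ereal (I s t) + ereal e" .
  qed
qed

end

end

theorem lemma2p12:
  fixes \<alpha> \<tau>\<^sub>1 \<tau>\<^sub>2 q s\<^sub>1 s\<^sub>2 t\<^sub>1 t\<^sub>2 :: real and p :: rat
  assumes "\<alpha> > 0" and "\<tau>\<^sub>1 \<ge> 0" and "\<tau>\<^sub>2 > 0"
    and "1 \<le> q" and "q < 4"
    and "1 \<le> p" and "p < 4" and "odd (snd (quotient_of p))"
    and "s\<^sub>1 \<ge> 0" and "s\<^sub>2 \<ge> 0" and "t\<^sub>1 \<ge> 0" and "t\<^sub>2 \<ge> 0"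
    and "s\<^sub>1 + s\<^sub>2 > 0" and "t\<^sub>1 + t\<^sub>2 > 0" and "s\<^sub>1 + t\<^sub>1 > 0" and "s\<^sub>2 + t\<^sub>2 > 0"
  shows "min_energy \<alpha> \<tau>\<^sub>1 \<tau>\<^sub>2 q p (s\<^sub>1 + s\<^sub>2) (t\<^sub>1 + t\<^sub>2)
         < min_energy \<alpha> \<tau>\<^sub>1 \<tau>\<^sub>2 q p s\<^sub>1 t\<^sub>1 + min_energy \<alpha> \<tau>\<^sub>1 \<tau>\<^sub>2 q p s\<^sub>2 t\<^sub>2"
proof -
  have p: "1 \<le> real_of_rat p" "real_of_rat p < 4"
    using assms(6,7) of_rat_less_eq[of 1 p, where 'a = real] of_rat_less[of p 4, where 'a = real] by auto
  have b: "0 < 2 * \<tau>\<^sub>2 / ((real_of_rat p + 1) * (real_of_rat p + 2))"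
    by (intro divide_pos_pos mult_pos_pos) (use p(1) assms(3) in linarith)+
  interpret nls_kdv \<alpha> "2 * \<tau>\<^sub>1 / (q + 2)" "2 * \<tau>\<^sub>2 / ((of_rat p + 1) * (of_rat p + 2))" q "of_rat p"
    by unfold_locales (fact assms p b | use assms(2,4) in simp)+
  \<comment> \<open>The three equations relating coefficients and exponent hold by reflexivity,
    since the locale is instantiated with these very terms.\<close>
  note eq = min_energy_eq_I[OF refl refl refl]
  show ?thesis
    using I_strictly_subadditive[of s\<^sub>1 s\<^sub>2 t\<^sub>1 t\<^sub>2] assms(9-16) by (simp add: eq)
qed

end
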